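(* Let $\mathcal{O}_0$ be a finite set of closed formulas of $\Omega$, let $\varphi$ be a closed formula of $\Omega$, let $\Gamma=\mathcal{O}_0\cup\{\varphi\}$, and let $\Delta_0$ be the set of all constants occurring in formulas of $\Gamma$. Then in the finite variation of the game, Proponent has a winning strategy starting from the position $\mathcal{C}_0=(\mathcal{O}_0,\{\varphi\},\Delta_0)$ if and only if $\mathcal{O}_0\vDash_{finCas}\varphi$.
   Context: Language: $\Omega$ is a first-order intuitionistic language with predicate symbols and constants but no function symbols; connectives $\to,\wedge,\vee,\bot$ and quantifiers $\forall,\exists$; $\neg A$ abbreviates $A\to\bot$. Kripke frames are partially ordered sets of worlds together with an individual domain $\Delta_w$ at each world $w$, monotone along the order (the domains are considered part of the frame); a Kripke model adds an interpretation of constants and a monotone interpretation of atomic formulas, with the usual intuitionistic forcing clauses. For a class $X$ of frames, $T\vDash_X\varphi$ means: for every Kripke model based on a frame in $X$, if every formula of $T$ is true at every world of the model, then $\varphi$ is true at every world. $Cas$ (Casari's class) is the class of all Kripke frames on which Casari's formula $\forall x[(P[x]\to\forall xP[x])\to\forall xP[x]]\to\forall xP[x]$ is valid; equivalently, frames in which along every countable increasing sequence of worlds the individual domains are finite and eventually stabilize. $finCas$ is the class of frames in $Cas$ all of whose individual domains are finite. The game. For a set of formulas $\Gamma$ and a set $\Delta$ of objects, $\mathcal{F}(\Gamma,\Delta)$ is the set of all formulas $P[c_1,\dots,c_n]$ where $P[x_1,\dots,x_n]$ is a subformula of some formula of $\Gamma$ whose free variables are among $x_1,\dots,x_n$ and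 $c_i\in\Delta$. A position is a triple $\mathcal{C}=(\mathcal{O},\mathcal{P},\Delta)$ with $\mathcal{O},\mathcal{P}\subseteq\mathcal{F}(\Gamma,\Delta)$, where $\Gamma$ is fixed at the start as $\mathcal{O}_0\cup\{\varphi\}$. Proponent moves by adding formulas of $\mathcal{F}(\Gamma,\Delta)$ to $\mathcal{P}$. Opponent moves by first extending $\Delta$ to some $\Delta'\supseteq\Delta$ (possibly $\Delta'=\Delta$; new elements may be arbitrary new objects) and then adding formulas of $\mathcal{F}(\Gamma,\Delta')$ to $\mathcal{O}$. In the finite variation of the game, $\Delta_0$ is finite and Opponent may add only finitely many new elements to $\Delta$ in a single move. Truth in a position, for formulas of $\mathcal{F}(\Gamma,\Delta)$: $\mathcal{C}\nVdash\bot$; for atomic $A[c_1,\dots,c_n]$, $\mathcal{C}\Vdash A[c_1,\dots,c_n]$ iff $A[c_1,\dots,c_n]\in\mathcal{O}$; for $\star\in\{\to,\wedge,\vee\}$, $\mathcal{C}\Vdash\psi\star\chi$ iff $\psi\star\chi\in\mathcal{O}\cup\mathcal{P}$ and $(\mathcal{C}\Vdash\psi)\star(\mathcal{C}\Vdash\chi)$ holds with $\star$ read classically; for $q\in\{\forall,\exists\}$, $\mathcal{C}\Vdash qxP[x]$ iff $qxP[x]\in\mathcal{O}\cup\mathcal{P}$ and for $q$ (read classically) $\alpha\in\Delta$, $\mathcal{C}\Vdash P[\alpha]$. A formula of $\mathcal{P}$ (resp. $\mathcal{O}$) false in the current position is a mistake of Proponent (resp. Opponent). If Opponent has no mistakes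 but Proponent has a mistake, Proponent must move; otherwise Opponent must move. If after a player's move that same player must move again, that player loses and the game ends. If the game continues infinitely, Proponent wins.
   Formalization: In the consequence relation, models interpret only constants occurring in Γ, and domains may be empty; otherwise the claim fails for constant-free Γ, e.g. φ = ∃x(Px→Px) with no premises, which holds on nonempty domains although Proponent loses at once. *)

theory Defs
  imports Main
begin

datatype (trm_consts: 'c) trm = Var nat | Const 'c

(* A predicate symbol is a name together with the length of its argument list. *)
datatype ('p, fm_consts: 'c) fm =
    Bot
  | Atom 'p "'c trm list"
  | Imp "('p, 'c) fm" "('p, 'c) fm"
  | And "('p, 'c) fm" "('p, 'c) fm"
  | Or "('p, 'c) fm" "('p, 'c) fm"
  | All nat "('p, 'c) fm"
  | Ex nat "('p, 'c) fm"

primrec trm_vars :: "'c trm \<Rightarrow> nat set" where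
  "trm_vars (Var x) = {x}"
| "trm_vars (Const c) = {}"

primrec free_vars :: "('p, 'c) fm \<Rightarrow> nat set" where
  "free_vars Bot = {}"
| "free_vars (Atom p ts) = (\<Union>t\<in>set ts. trm_vars t)"
| "free_vars (Imp A B) = free_vars A \<union> free_vars B"
| "free_vars (And A B) = free_vars A \<union> free_vars B"
| "free_vars (Or A B) = free_vars A \<union> free_vars B"
| "free_vars (All x A) = free_vars A - {x}"
| "free_vars (Ex x A) = free_vars A - {x}"

definition closed_fm :: "('p, 'c) fm \<Rightarrow> bool" where
  "closed_fm A \<longleftrightarrow> free_vars A = {}"

primrec subfms :: "('p, 'c) fm \<Rightarrow> ('p, 'c) fm set" where
  "subfms Bot = {Bot}"
| "subfms (Atom p ts) = {Atom p ts}"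
| "subfms (Imp A B) = {Imp A B} \<union> subfms A \<union> subfms B"
| "subfms (And A B) = {And A B} \<union> subfms A \<union> subfms B"
| "subfms (Or A B) = {Or A B} \<union> subfms A \<union> subfms B"
| "subfms (All x A) = {All x A} \<union> subfms A"
| "subfms (Ex x A) = {Ex x A} \<union> subfms A"

primrec inst_trm :: "(nat \<Rightarrow> 'c trm) \<Rightarrow> 'c trm \<Rightarrow> 'c trm" where
  "inst_trm s (Var x) = s x"
| "inst_trm s (Const c) = Const c"

(* Only used with s x a constant or Var x itself, so no variable can be captured. *)
primrec inst :: "(nat \<Rightarrow> 'c trm) \<Rightarrow> ('p, 'c) fm \<Rightarrow> ('p, 'c) fm" where
  "inst s Bot = Bot"
| "inst s (Atom p ts) = Atom p (map (inst_trm s) ts)"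
| "inst s (Imp A B) = Imp (inst s A) (inst s B)"
| "inst s (And A B) = And (inst s A) (inst s B)"
| "inst s (Or A B) = Or (inst s A) (inst s B)"
| "inst s (All x A) = All x (inst (s(x := Var x)) A)"
| "inst s (Ex x A) = Ex x (inst (s(x := Var x)) A)"

definition subst1 :: "nat \<Rightarrow> 'c \<Rightarrow> ('p, 'c) fm \<Rightarrow> ('p, 'c) fm" where
  "subst1 x c A = inst (Var(x := Const c)) A"

primrec height :: "('p, 'c) fm \<Rightarrow> nat" where
  "height Bot = 0"
| "height (Atom p ts) = 0"
| "height (Imp A B) = Suc (height A + height B)"
| "height (And A B) = Suc (height A + height B)"
| "height (Or A B) = Suc (height A + height B)"
| "height (All x A) = Suc (height A)"
| "height (Ex x A) = Suc (height A)"

lemma height_inst [simp]: "height (inst s A) = height A"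
  by (induction A arbitrary: s) auto

lemma height_subst1 [simp]: "height (subst1 x c A) = height A"
  by (simp add: subst1_def)


section \<open>Kripke semantics\<close>

record ('w, 'd) kframe =
  worlds :: "'w set"
  acc :: "('w \<times> 'w) set"
  indiv :: "'w \<Rightarrow> 'd set"

(* Domains may be empty, in parallel with the empty set of objects from which
   the game starts when no constants occur. *)
definition kripke_frame :: "('w, 'd) kframe \<Rightarrow> bool" where
  "kripke_frame F \<longleftrightarrow>
     partial_order_on (worlds F) (acc F) \<and>
     (\<forall>w v. (w, v) \<in> acc F \<longrightarrow> indiv F w \<subseteq> indiv F v)"

record ('w, 'd, 'p, 'c) kmodel =
  frame :: "('w, 'd) kframe"
  cint :: "'w \<Rightarrow> 'c \<Rightarrow> 'd"
  pint :: "'w \<Rightarrow> 'p \<Rightarrow> 'd list set"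

(* A model of the language whose constants are those in K; the values of cint
   outside K are irrelevant.  Constants keep their denotation along the order, but
   order-disconnected worlds, whose domains may be disjoint, are independent. *)
definition kripke_model :: "'c set \<Rightarrow> ('w, 'd, 'p, 'c) kmodel \<Rightarrow> bool" where
  "kripke_model K M \<longleftrightarrow>
     kripke_frame (frame M) \<and>
     (\<forall>w\<in>worlds (frame M). \<forall>c\<in>K. cint M w c \<in> indiv (frame M) w) \<and>
     (\<forall>w v. (w, v) \<in> acc (frame M) \<longrightarrow> (\<forall>c\<in>K. cint M w c = cint M v c)) \<and>
     (\<forall>w\<in>worlds (frame M). \<forall>p. pint M w p \<subseteq> lists (indiv (frame M) w)) \<and>
     (\<forall>w v. (w, v) \<in> acc (frame M) \<longrightarrow> (\<forall>p. pint M w p \<subseteq> pint M v p))"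

primrec trm_val :: "('c \<Rightarrow> 'd) \<Rightarrow> (nat \<Rightarrow> 'd) \<Rightarrow> 'c trm \<Rightarrow> 'd" where
  "trm_val I e (Var x) = e x"
| "trm_val I e (Const c) = I c"

primrec forces ::
    "('w, 'd, 'p, 'c) kmodel \<Rightarrow> 'w \<Rightarrow> (nat \<Rightarrow> 'd) \<Rightarrow> ('p, 'c) fm \<Rightarrow> bool" where
  "forces M w e Bot \<longleftrightarrow> False"
| "forces M w e (Atom p ts) \<longleftrightarrow> map (trm_val (cint M w) e) ts \<in> pint M w p"
| "forces M w e (Imp A B) \<longleftrightarrow>
     (\<forall>v. (w, v) \<in> acc (frame M) \<longrightarrow> forces M v e A \<longrightarrow> forces M v e B)"
| "forces M w e (And A B) \<longleftrightarrow> forces M w e A \<and> forces M w e B"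
| "forces M w e (Or A B) \<longleftrightarrow> forces M w e A \<or> forces M w e B"
| "forces M w e (All x A) \<longleftrightarrow>
     (\<forall>v. (w, v) \<in> acc (frame M) \<longrightarrow> (\<forall>d\<in>indiv (frame M) v. forces M v (e(x := d)) A))"
| "forces M w e (Ex x A) \<longleftrightarrow> (\<exists>d\<in>indiv (frame M) w. forces M w (e(x := d)) A)"

(* For closed formulas, where the assignment e is irrelevant. *)
definition true_at :: "('w, 'd, 'p, 'c) kmodel \<Rightarrow> 'w \<Rightarrow> ('p, 'c) fm \<Rightarrow> bool" where
  "true_at M w A \<longleftrightarrow> (\<forall>e. forces M w e A)"

definition frame_valid :: "('w, 'd) kframe \<Rightarrow> ('p, 'c) fm \<Rightarrow> bool" where
  "frame_valid F A \<longleftrightarrow>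
     (\<forall>M :: ('w, 'd, 'p, 'c) kmodel. kripke_model (fm_consts A) M \<and> frame M = F \<longrightarrow>
        (\<forall>w\<in>worlds F. true_at M w A))"

(* The models are those of the language whose constants occur in T or A.  If a model
   had to interpret further constants, domains could not be empty, and consequence
   between constant-free formulas would depend on the ambient language. *)
definition consequence ::
    "('p, 'c) fm set \<Rightarrow> ('w, 'd) kframe set \<Rightarrow> ('p, 'c) fm \<Rightarrow> bool" where
  "consequence T X A \<longleftrightarrow>
     (\<forall>M :: ('w, 'd, 'p, 'c) kmodel.
        kripke_model (\<Union>B\<in>T \<union> {A}. fm_consts B) M \<and> frame M \<in> X \<longrightarrow>
        (\<forall>B\<in>T. \<forall>w\<in>worlds (frame M). true_at M w B) \<longrightarrow>
        (\<forall>w\<in>worlds (frame M). true_at M w A))"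

definition casari :: "(unit, unit) fm" where
  "casari =
     (let P = Atom () [Var 0]
      in Imp (All 0 (Imp (Imp P (All 0 P)) (All 0 P))) (All 0 P))"

definition Cas :: "('w, 'd) kframe set" where
  "Cas = {F. kripke_frame F \<and> frame_valid F casari}"

definition finCas :: "('w, 'd) kframe set" where
  "finCas = {F \<in> Cas. \<forall>w\<in>worlds F. finite (indiv F w)}"


section \<open>The game\<close>

(* The objects of the game are the elements of the type 'a of the constants, so that an
   object can be put into a formula as a constant.  Objects not occurring in the initial
   formulas serve as the new objects; the type has to be infinite for them not to run out. *)

definition inst_fms :: "('p, 'a) fm set \<Rightarrow> 'a set \<Rightarrow> ('p, 'a) fm set" where
  "inst_fms \<Gamma> \<Delta> =
     {inst (\<lambda>x. Const (e x)) A | e A. (\<exists>G\<in>\<Gamma>. A \<in> subfms G) \<and> e ` free_vars A \<subseteq> \<Delta>}"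

record ('p, 'a) position =
  opp :: "('p, 'a) fm set"
  prp :: "('p, 'a) fm set"
  objs :: "'a set"

function (sequential) pos_true :: "('p, 'a) position \<Rightarrow> ('p, 'a) fm \<Rightarrow> bool" where
  "pos_true C Bot \<longleftrightarrow> False"
| "pos_true C (Atom p ts) \<longleftrightarrow> Atom p ts \<in> opp C"
| "pos_true C (Imp A B) \<longleftrightarrow>
     Imp A B \<in> opp C \<union> prp C \<and> (pos_true C A \<longrightarrow> pos_true C B)"
| "pos_true C (And A B) \<longleftrightarrow>
     And A B \<in> opp C \<union> prp C \<and> (pos_true C A \<and> pos_true C B)"
| "pos_true C (Or A B) \<longleftrightarrow>
     Or A B \<in> opp C \<union> prp C \<and> (pos_true C A \<or> pos_true C B)"
| "pos_true C (All x A) \<longleftrightarrow>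
     All x A \<in> opp C \<union> prp C \<and> (\<forall>a\<in>objs C. pos_true C (subst1 x a A))"
| "pos_true C (Ex x A) \<longleftrightarrow>
     Ex x A \<in> opp C \<union> prp C \<and> (\<exists>a\<in>objs C. pos_true C (subst1 x a A))"
  by pat_completeness auto
termination
  by (relation "measure (\<lambda>(C, A). height A)") auto

definition opp_mistakes :: "('p, 'a) position \<Rightarrow> ('p, 'a) fm set" where
  "opp_mistakes C = {A \<in> opp C. \<not> pos_true C A}"

definition prp_mistakes :: "('p, 'a) position \<Rightarrow> ('p, 'a) fm set" where
  "prp_mistakes C = {A \<in> prp C. \<not> pos_true C A}"

definition prp_turn :: "('p, 'a) position \<Rightarrow> bool" where
  "prp_turn C \<longleftrightarrow> opp_mistakes C = {} \<and> prp_mistakes C \<noteq> {}"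

definition prp_move ::
    "('p, 'a) fm set \<Rightarrow> ('p, 'a) position \<Rightarrow> ('p, 'a) position \<Rightarrow> bool" where
  "prp_move \<Gamma> C C' \<longleftrightarrow>
     (\<exists>N \<subseteq> inst_fms \<Gamma> (objs C). C' = C\<lparr>prp := prp C \<union> N\<rparr>)"

definition fin_opp_move ::
    "('p, 'a) fm set \<Rightarrow> ('p, 'a) position \<Rightarrow> ('p, 'a) position \<Rightarrow> bool" where
  "fin_opp_move \<Gamma> C C' \<longleftrightarrow>
     (\<exists>E N. finite E \<and> N \<subseteq> inst_fms \<Gamma> (objs C \<union> E) \<and>
        C' = C\<lparr>opp := opp C \<union> N, objs := objs C \<union> E\<rparr>)"

definition fin_move ::
    "('p, 'a) fm set \<Rightarrow> ('p, 'a) position \<Rightarrow> ('p, 'a) position \<Rightarrow> bool" where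
  "fin_move \<Gamma> C C' \<longleftrightarrow>
     (if prp_turn C then prp_move \<Gamma> C C' else fin_opp_move \<Gamma> C C')"

(* The player who made the last move must move again, and thereby has lost. *)
definition ended :: "('p, 'a) position list \<Rightarrow> bool" where
  "ended h \<longleftrightarrow> length h \<ge> 2 \<and> prp_turn (last h) = prp_turn (last (butlast h))"

(* The finite initial segments of plays, as lists of the successive positions. *)
inductive_set fin_plays ::
    "('p, 'a) fm set \<Rightarrow> ('p, 'a) position \<Rightarrow> ('p, 'a) position list set"
  for \<Gamma> C\<^sub>0 where
  start: "[C\<^sub>0] \<in> fin_plays \<Gamma> C\<^sub>0"
| move: "h \<in> fin_plays \<Gamma> C\<^sub>0 \<Longrightarrow> \<not> ended h \<Longrightarrow> fin_move \<Gamma> (last h) C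
    \<Longrightarrow> h @ [C] \<in> fin_plays \<Gamma> C\<^sub>0"

definition prp_strategy ::
    "('p, 'a) fm set \<Rightarrow> ('p, 'a) position \<Rightarrow> (('p, 'a) position list \<Rightarrow> ('p, 'a) position) \<Rightarrow> bool"
  where
  "prp_strategy \<Gamma> C\<^sub>0 \<sigma> \<longleftrightarrow>
     (\<forall>h\<in>fin_plays \<Gamma> C\<^sub>0. \<not> ended h \<and> prp_turn (last h) \<longrightarrow> prp_move \<Gamma> (last h) (\<sigma> h))"

definition follows ::
    "(('p, 'a) position list \<Rightarrow> ('p, 'a) position) \<Rightarrow> ('p, 'a) position list \<Rightarrow> bool" where
  "follows \<sigma> h \<longleftrightarrow>
     (\<forall>i. Suc i < length h \<and> prp_turn (h ! i) \<longrightarrow> h ! Suc i = \<sigma> (take (Suc i) h))"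

(* Infinite plays are won by Proponent, so only the plays that end are constrained;
   these are lost by the player whose turn it is in the last position. *)
definition prp_winning_strategy ::
    "('p, 'a) fm set \<Rightarrow> ('p, 'a) position \<Rightarrow> (('p, 'a) position list \<Rightarrow> ('p, 'a) position) \<Rightarrow> bool"
  where
  "prp_winning_strategy \<Gamma> C\<^sub>0 \<sigma> \<longleftrightarrow>
     prp_strategy \<Gamma> C\<^sub>0 \<sigma> \<and>
     (\<forall>h\<in>fin_plays \<Gamma> C\<^sub>0. follows \<sigma> h \<and> ended h \<longrightarrow> \<not> prp_turn (last h))"

end

theory Submission
  imports Defs
begin

text \<open>
  Given a countermodel, Opponent plays along it: the position is tied to a world, and Opponent always
  moves to a world above that still refutes some formula of Proponent and has, among these worlds, a
  maximal domain and a maximal theory; such a maximal domain exists because Casari's formula excludes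
  infinite chains of growing domains.  Truth in the position is then forcing at the world, so Opponent
  makes no mistakes and Proponent must keep adding formulas, which the finite, eventually constant
  domain does not allow for ever.

  Conversely, Proponent always adds all consequences (over finite tree models) of what Opponent has
  asserted.  If Proponent had to move again, countermodels to the remaining formulas, glued under a new
  root that carries the objects of the position and the atoms asserted by Opponent, would form a tree
  model at whose root forcing is truth in the position: there Opponent's formulas hold, but one of
  their consequences fails.
\<close>

section \<open>Instances of subformulas\<close>

text \<open>Truth in a position is classical, whereas forcing of implications and universal formulas
  looks at higher worlds. \<open>pos_true_iff_true_at\<close> isolates a condition under which this
  difference vanishes, and both directions are built to meet it: Opponent's double maximality turns
  any higher world that fails an asserted formula into a copy of the current one, while strictly
  above the glued root no asserted formula fails at all. The domain has to be maximised before the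
  theory, because a theory is measured in instances over the objects of the position, and these are
  settled only once every individual has a name. The types of worlds and individuals in
  \<open>consequence\<close> are arbitrary infinite ones, so a large canonical model cannot be
  expected to fit into them. Finite trees avoid this obstacle: what lies above a node is finite and
  embeds into any infinite type.\<close>

lemma finite_trm_vars [simp]: "finite (trm_vars t)"
  by (cases t) auto

lemma finite_free_vars [simp]: "finite (free_vars A)"
  by (induction A) auto

lemma finite_trm_consts [simp]: "finite (trm_consts t)"
  by (cases t) auto

lemma finite_fm_consts [simp]: "finite (fm_consts A)"
  by (induction A) auto

lemma finite_subfms [simp]: "finite (subfms A)"
  by (induction A) auto

lemma subfms_refl [simp]: "A \<in> subfms A"
  by (cases A) auto

lemma subfms_trans: "A \<in> subfms B \<Longrightarrow> B \<in> subfms C \<Longrightarrow> A \<in> subfms C"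
  by (induction C) auto

lemma fm_consts_subfms: "A \<in> subfms B \<Longrightarrow> fm_consts A \<subseteq> fm_consts B"
  by (induction B) auto

lemma inst_trm_cong: "(\<And>x. x \<in> trm_vars t \<Longrightarrow> s x = s' x) \<Longrightarrow> inst_trm s t = inst_trm s' t"
  by (cases t) auto

lemma inst_cong: "(\<And>x. x \<in> free_vars A \<Longrightarrow> s x = s' x) \<Longrightarrow> inst s A = inst s' A"
proof (induction A arbitrary: s s')
  case (All x A)
  show ?case
    using All.prems by (auto intro!: All.IH)
next
  case (Ex x A)
  show ?case
    using Ex.prems by (auto intro!: Ex.IH)
next
  case (Atom p ts)
  then show ?case
    by (auto intro!: inst_trm_cong)
next
  case (Imp A B)
  then show ?case
    by (metis UnI1 UnI2 free_vars.simps(3) inst.simps(3))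
next
  case (And A B)
  then show ?case
    by (metis UnI1 UnI2 free_vars.simps(4) inst.simps(4))
next
  case (Or A B)
  then show ?case
    by (metis UnI1 UnI2 free_vars.simps(5) inst.simps(5))
qed simp

lemma inst_trm_Var [simp]: "inst_trm Var t = t"
  by (cases t) auto

lemma inst_Var [simp]: "inst Var A = A"
  by (induction A) (auto intro: map_idI)

text \<open>A variable is either left alone or replaced by a constant, so a substitution of this
  kind brings no other variable under a binder; this is what lets instances compose.\<close>

definition ground_subst :: "(nat \<Rightarrow> 'c trm) \<Rightarrow> bool" where
  "ground_subst s \<longleftrightarrow> (\<forall>x. s x = Var x \<or> (\<exists>c. s x = Const c))"

lemma ground_subst_upd [simp]: "ground_subst s \<Longrightarrow> ground_subst (s(x := Var x))"
  by (auto simp: ground_subst_def)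

lemma ground_subst_Const [simp]: "ground_subst (\<lambda>x. Const (e x))"
  by (auto simp: ground_subst_def)

lemma ground_subst_Var_upd [simp]: "ground_subst (Var(x := Const c))"
  by (auto simp: ground_subst_def)

lemma free_vars_inst:
  "ground_subst s \<Longrightarrow> free_vars (inst s A) = (\<Union>x\<in>free_vars A. trm_vars (s x))"
proof (induction A arbitrary: s)
  case (Atom p ts)
  have "trm_vars (inst_trm s t) = (\<Union>x\<in>trm_vars t. trm_vars (s x))" for t
    by (cases t) auto
  then show ?case
    by auto
next
  case (All y A)
  have "trm_vars (s x) \<subseteq> {x}" for x
    using All.prems unfolding ground_subst_def by (metis empty_subsetI order_refl trm_vars.simps)
  with All show ?case
    by (fastforce split: if_splits)
next
  case (Ex y A)
  have "trm_vars (s x) \<subseteq> {x}" for x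
    using Ex.prems unfolding ground_subst_def by (metis empty_subsetI order_refl trm_vars.simps)
  with Ex show ?case
    by (fastforce split: if_splits)
qed auto

lemma fm_consts_inst:
  "fm_consts (inst s A) \<subseteq> fm_consts A \<union> (\<Union>x\<in>free_vars A. trm_consts (s x))"
proof (induction A arbitrary: s)
  case (Atom p ts)
  have "trm_consts (inst_trm s t) \<subseteq> trm_consts t \<union> (\<Union>x\<in>trm_vars t. trm_consts (s x))" for t
    by (cases t) auto
  then show ?case
    by fastforce
next
  case (All y A)
  have "(\<Union>x\<in>free_vars A. trm_consts ((s(y := Var y)) x)) \<subseteq> (\<Union>x\<in>free_vars A - {y}. trm_consts (s x))"
    by (auto split: if_splits)
  then have "fm_consts (inst (s(y := Var y)) A) \<subseteq> fm_consts A \<union> (\<Union>x\<in>free_vars A - {y}. trm_consts (s x))"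
    by (rule order_trans[OF All Un_mono[OF subset_refl]])
  then show ?case
    by simp
next
  case (Ex y A)
  have "(\<Union>x\<in>free_vars A. trm_consts ((s(y := Var y)) x)) \<subseteq> (\<Union>x\<in>free_vars A - {y}. trm_consts (s x))"
    by (auto split: if_splits)
  then have "fm_consts (inst (s(y := Var y)) A) \<subseteq> fm_consts A \<union> (\<Union>x\<in>free_vars A - {y}. trm_consts (s x))"
    by (rule order_trans[OF Ex Un_mono[OF subset_refl]])
  then show ?case
    by simp
qed fastforce+

lemma inst_inst:
  "ground_subst r \<Longrightarrow> inst s (inst r A) = inst (\<lambda>x. inst_trm s (r x)) A"
proof (induction A arbitrary: r s)
  case (Atom p ts)
  have "inst_trm s (inst_trm r t) = inst_trm (\<lambda>x. inst_trm s (r x)) t" for t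
    by (cases t) auto
  then show ?case
    by simp
next
  case (All y A)
  \<comment> \<open>Under the binder, \<open>r x\<close> is \<open>Var x\<close> or a constant;
    hence no variable other than \<open>y\<close> is mapped to \<open>Var y\<close>, and shielding
    \<open>y\<close> commutes with composition.\<close>
  have "inst_trm (s(y := Var y)) ((r(y := Var y)) x) = ((\<lambda>x. inst_trm s (r x))(y := Var y)) x" for x
  proof (cases "r x")
    case (Var z)
    then have "z = x"
      using All.prems unfolding ground_subst_def by (metis trm.distinct(1) trm.inject(1))
    with Var show ?thesis
      by simp
  qed simp
  then show ?case
    using All.prems by (simp add: All.IH del: fun_upd_apply)
next
  case (Ex y A)
  have "inst_trm (s(y := Var y)) ((r(y := Var y)) x) = ((\<lambda>x. inst_trm s (r x))(y := Var y)) x" for x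
  proof (cases "r x")
    case (Var z)
    then have "z = x"
      using Ex.prems unfolding ground_subst_def by (metis trm.distinct(1) trm.inject(1))
    with Var show ?thesis
      by simp
  qed simp
  then show ?case
    using Ex.prems by (simp add: Ex.IH del: fun_upd_apply)
qed auto

text \<open>Closure of \<open>inst_fms\<close> under quantifier instances rests on this: filling the
  variable that the quantifier leaves open amounts to updating the assignment.\<close>

lemma subst1_inst_Const:
  "subst1 x a (inst ((\<lambda>y. Const (e y))(x := Var x)) A) = inst (\<lambda>y. Const ((e(x := a)) y)) A"
proof -
  have "(\<lambda>y. inst_trm (Var(x := Const a)) (((\<lambda>y. Const (e y))(x := Var x)) y)) =
      (\<lambda>y. Const ((e(x := a)) y))"
    by auto
  then show ?thesis
    by (simp add: subst1_def inst_inst del: fun_upd_apply)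
qed

lemma inst_fms_cases:
  assumes "F \<in> inst_fms \<Gamma> \<Delta>"
  obtains e A G where "F = inst (\<lambda>x. Const (e x)) A" "G \<in> \<Gamma>" "A \<in> subfms G"
    "e ` free_vars A \<subseteq> \<Delta>"
  using assms unfolding inst_fms_def by blast

lemma inst_fmsI:
  "G \<in> \<Gamma> \<Longrightarrow> A \<in> subfms G \<Longrightarrow> e ` free_vars A \<subseteq> \<Delta> \<Longrightarrow> inst (\<lambda>x. Const (e x)) A \<in> inst_fms \<Gamma> \<Delta>"
  unfolding inst_fms_def by blast

lemma inst_fms_mono: "\<Delta> \<subseteq> \<Delta>' \<Longrightarrow> inst_fms \<Gamma> \<Delta> \<subseteq> inst_fms \<Gamma> \<Delta>'"
  unfolding inst_fms_def by blast

lemma inst_fms_closed [simp]: "F \<in> inst_fms \<Gamma> \<Delta> \<Longrightarrow> free_vars F = {}"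
  by (auto elim!: inst_fms_cases simp: free_vars_inst)

lemma inst_fms_consts:
  assumes "F \<in> inst_fms \<Gamma> \<Delta>" "(\<Union>G\<in>\<Gamma>. fm_consts G) \<subseteq> \<Delta>"
  shows "fm_consts F \<subseteq> \<Delta>"
proof -
  obtain e A G where *: "F = inst (\<lambda>x. Const (e x)) A" "G \<in> \<Gamma>" "A \<in> subfms G"
    "e ` free_vars A \<subseteq> \<Delta>"
    using assms(1) by (rule inst_fms_cases)
  then have "fm_consts A \<subseteq> \<Delta>"
    using fm_consts_subfms[OF *(3)] *(2) assms(2) by blast
  moreover have "(\<Union>x\<in>free_vars A. trm_consts (Const (e x))) \<subseteq> \<Delta>"
    using *(4) by auto
  ultimately show ?thesis
    unfolding *(1) using fm_consts_inst[of "\<lambda>x. Const (e x)" A] by (meson Un_least subset_trans)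
qed

lemma closed_in_inst_fms: "closed_fm G \<Longrightarrow> G \<in> \<Gamma> \<Longrightarrow> G \<in> inst_fms \<Gamma> \<Delta>"
  using inst_fmsI[of G \<Gamma> G "\<lambda>_. undefined" \<Delta>] inst_cong[of G Var "\<lambda>_. Const undefined"]
  by (auto simp: closed_fm_def)

lemma inst_fms_Imp:
  assumes "Imp A B \<in> inst_fms \<Gamma> \<Delta>"
  shows "A \<in> inst_fms \<Gamma> \<Delta>" "B \<in> inst_fms \<Gamma> \<Delta>"
proof -
  obtain e F G where *: "Imp A B = inst (\<lambda>x. Const (e x)) F" "G \<in> \<Gamma>" "F \<in> subfms G"
    "e ` free_vars F \<subseteq> \<Delta>"
    using assms by (rule inst_fms_cases)
  then obtain A' B' where F: "F = Imp A' B'"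
    by (cases F) auto
  then have "A' \<in> subfms G" "B' \<in> subfms G"
    using * subfms_trans[of _ F G] by auto
  then show "A \<in> inst_fms \<Gamma> \<Delta>" "B \<in> inst_fms \<Gamma> \<Delta>"
    using * F by (auto intro!: inst_fmsI)
qed

lemma inst_fms_And:
  assumes "And A B \<in> inst_fms \<Gamma> \<Delta>"
  shows "A \<in> inst_fms \<Gamma> \<Delta>" "B \<in> inst_fms \<Gamma> \<Delta>"
proof -
  obtain e F G where *: "And A B = inst (\<lambda>x. Const (e x)) F" "G \<in> \<Gamma>" "F \<in> subfms G"
    "e ` free_vars F \<subseteq> \<Delta>"
    using assms by (rule inst_fms_cases)
  then obtain A' B' where F: "F = And A' B'"
    by (cases F) auto
  then have "A' \<in> subfms G" "B' \<in> subfms G"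
    using * subfms_trans[of _ F G] by auto
  then show "A \<in> inst_fms \<Gamma> \<Delta>" "B \<in> inst_fms \<Gamma> \<Delta>"
    using * F by (auto intro!: inst_fmsI)
qed

lemma inst_fms_Or:
  assumes "Or A B \<in> inst_fms \<Gamma> \<Delta>"
  shows "A \<in> inst_fms \<Gamma> \<Delta>" "B \<in> inst_fms \<Gamma> \<Delta>"
proof -
  obtain e F G where *: "Or A B = inst (\<lambda>x. Const (e x)) F" "G \<in> \<Gamma>" "F \<in> subfms G"
    "e ` free_vars F \<subseteq> \<Delta>"
    using assms by (rule inst_fms_cases)
  then obtain A' B' where F: "F = Or A' B'"
    by (cases F) auto
  then have "A' \<in> subfms G" "B' \<in> subfms G"
    using * subfms_trans[of _ F G] by auto
  then show "A \<in> inst_fms \<Gamma> \<Delta>" "B \<in> inst_fms \<Gamma> \<Delta>"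
    using * F by (auto intro!: inst_fmsI)
qed

lemma inst_fms_All:
  assumes "All x A \<in> inst_fms \<Gamma> \<Delta>" "a \<in> \<Delta>"
  shows "subst1 x a A \<in> inst_fms \<Gamma> \<Delta>"
proof -
  obtain e F G where *: "All x A = inst (\<lambda>x. Const (e x)) F" "G \<in> \<Gamma>" "F \<in> subfms G"
    "e ` free_vars F \<subseteq> \<Delta>"
    using assms(1) by (rule inst_fms_cases)
  then obtain A' where F: "F = All x A'"
    by (cases F) auto
  then have A: "A = inst ((\<lambda>y. Const (e y))(x := Var x)) A'"
    using * by simp
  have "A' \<in> subfms G"
    using * F subfms_trans[of _ F G] by auto
  then show ?thesis
    unfolding A subst1_inst_Const using * F assms(2) by (intro inst_fmsI) auto
qed

lemma inst_fms_Ex: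
  assumes "Ex x A \<in> inst_fms \<Gamma> \<Delta>" "a \<in> \<Delta>"
  shows "subst1 x a A \<in> inst_fms \<Gamma> \<Delta>"
proof -
  obtain e F G where *: "Ex x A = inst (\<lambda>x. Const (e x)) F" "G \<in> \<Gamma>" "F \<in> subfms G"
    "e ` free_vars F \<subseteq> \<Delta>"
    using assms(1) by (rule inst_fms_cases)
  then obtain A' where F: "F = Ex x A'"
    by (cases F) auto
  then have A: "A = inst ((\<lambda>y. Const (e y))(x := Var x)) A'"
    using * by simp
  have "A' \<in> subfms G"
    using * F subfms_trans[of _ F G] by auto
  then show ?thesis
    unfolding A subst1_inst_Const using * F assms(2) by (intro inst_fmsI) auto
qed

lemma closed_Atom_args:
  assumes "free_vars (Atom p ts) = {}"
  obtains as where "ts = map Const as"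
proof -
  have "\<forall>t\<in>set ts. \<exists>a. t = Const a"
  proof
    fix t
    assume "t \<in> set ts"
    with assms show "\<exists>a. t = Const a"
      by (cases t) auto
  qed
  then have "\<exists>as. ts = map Const as"
    by (simp add: ex_map_conv)
  with that show ?thesis
    by blast
qed

lemma finite_inst_fms:
  fixes \<Gamma> :: "('p, 'a) fm set"
  assumes "finite \<Gamma>" "finite \<Delta>"
  shows "finite (inst_fms \<Gamma> \<Delta>)"
proof -
  \<comment> \<open>An instance depends on the assignment at the free variables only. Fixing the
    value \<open>undefined\<close> elsewhere leaves finitely many assignments.\<close>
  define E where "E A = {f. \<forall>x. (x \<in> free_vars A \<longrightarrow> f x \<in> \<Delta>) \<and> (x \<notin> free_vars A \<longrightarrow> f x = undefined)}"
    for A :: "('p, 'a) fm"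
  have "inst_fms \<Gamma> \<Delta> \<subseteq> (\<Union>G\<in>\<Gamma>. \<Union>A\<in>subfms G. (\<lambda>e. inst (\<lambda>x. Const (e x)) A) ` E A)"
  proof
    fix F
    assume "F \<in> inst_fms \<Gamma> \<Delta>"
    then obtain e A G where *: "F = inst (\<lambda>x. Const (e x)) A" "G \<in> \<Gamma>" "A \<in> subfms G"
      "e ` free_vars A \<subseteq> \<Delta>"
      by (rule inst_fms_cases)
    let ?e = "\<lambda>x. if x \<in> free_vars A then e x else undefined"
    have "F = inst (\<lambda>x. Const (?e x)) A"
      unfolding *(1) by (rule inst_cong) simp
    moreover have "?e \<in> E A"
      using *(4) by (auto simp: E_def)
    ultimately show "F \<in> (\<Union>G\<in>\<Gamma>. \<Union>A\<in>subfms G. (\<lambda>e. inst (\<lambda>x. Const (e x)) A) ` E A)"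
      by (intro UN_I[OF *(2)] UN_I[OF *(3)] image_eqI)
  qed
  moreover have "finite (\<Union>G\<in>\<Gamma>. \<Union>A\<in>subfms G. (\<lambda>e. inst (\<lambda>x. Const (e x)) A) ` E A)"
  proof -
    have "finite (E A)" for A
      unfolding E_def using assms(2) by (rule finite_set_of_finite_funs[OF finite_free_vars])
    then show ?thesis
      using assms(1) by (intro finite_UN_I finite_imageI finite_subfms)
  qed
  ultimately show ?thesis
    by (rule finite_subset)
qed


section \<open>Forcing\<close>

text \<open>Forcing at \<open>w\<close> only looks upward, so the interpretations of constants are
  compared at worlds above \<open>w\<close> alone. This matters because \<open>cint\<close> may vary
  between order-disconnected worlds.\<close>

lemma forces_cong:
  assumes "kripke_frame (frame M)" "frame M' = frame M" "pint M' = pint M"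
    and "w \<in> worlds (frame M)"
    and "\<And>v c. (w, v) \<in> acc (frame M) \<Longrightarrow> c \<in> fm_consts A \<Longrightarrow> cint M' v c = cint M v c"
    and "\<And>x. x \<in> free_vars A \<Longrightarrow> e' x = e x"
  shows "forces M' w e' A \<longleftrightarrow> forces M w e A"
proof -
  have refl: "refl_on (worlds (frame M)) (acc (frame M))" and tr: "trans (acc (frame M))"
    and sub: "acc (frame M) \<subseteq> worlds (frame M) \<times> worlds (frame M)"
    using assms(1) partial_order_onD unfolding kripke_frame_def by blast+
  have shift: "cint M' u c = cint M u c"
    if "\<And>v. (w, v) \<in> acc (frame M) \<Longrightarrow> cint M' v c = cint M v c"
      "(w, v) \<in> acc (frame M)" "(v, u) \<in> acc (frame M)" for w v u c
    using that tr by (meson transD)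
  show ?thesis
    using assms(4-)
  proof (induction A arbitrary: w e e')
    case (Atom p ts)
    have "(w, w) \<in> acc (frame M)"
      using refl Atom.prems(1) by (auto simp: refl_on_def)
    then have "trm_val (cint M' w) e' t = trm_val (cint M w) e t" if "t \<in> set ts" for t
      using that Atom.prems(2)[of w] Atom.prems(3) by - (cases t; force)
    then have "map (trm_val (cint M' w) e') ts = map (trm_val (cint M w) e) ts"
      by simp
    then show ?case
      by (simp only: forces.simps assms(3))
  next
    case (Imp A B)
    have "forces M' v e' A = forces M v e A \<and> forces M' v e' B = forces M v e B"
      if "(w, v) \<in> acc (frame M)" for v
      using that Imp.prems sub shift[of w _ v] by (intro conjI Imp.IH) auto
    with assms(2) show ?case
      by auto
  next
    case (And A B)
    have "forces M' w e' A = forces M w e A \<and> forces M' w e' B = forces M w e B"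
      using And.prems by (intro conjI And.IH) auto
    then show ?case
      by auto
  next
    case (Or A B)
    have "forces M' w e' A = forces M w e A \<and> forces M' w e' B = forces M w e B"
      using Or.prems by (intro conjI Or.IH) auto
    then show ?case
      by auto
  next
    case (All x A)
    have "forces M' v (e'(x := d)) A = forces M v (e(x := d)) A"
      if "(w, v) \<in> acc (frame M)" for v d
      using that All.prems sub shift[of w _ v] by (intro All.IH) auto
    with assms(2) show ?case
      by auto
  next
    case (Ex x A)
    have "forces M' w (e'(x := d)) A = forces M w (e(x := d)) A" for d
      using Ex.prems by (intro Ex.IH) auto
    with assms(2) show ?case
      by auto
  qed auto
qed

lemma true_at_closed:
  assumes "kripke_frame (frame M)" "w \<in> worlds (frame M)" "free_vars A = {}"
  shows "true_at M w A \<longleftrightarrow> forces M w e A"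
proof -
  have "forces M w e' A \<longleftrightarrow> forces M w e A" for e'
    by (rule forces_cong[OF assms(1) refl refl assms(2)]) (simp_all add: assms(3))
  then show ?thesis
    unfolding true_at_def by blast
qed

text \<open>\<open>kripke_model {}\<close> says nothing about constants, which may then denote
  anything, even outside the domains; their persistence is therefore a separate hypothesis.\<close>

lemma forces_mono:
  assumes M: "kripke_model {} M"
    and "\<forall>c\<in>fm_consts A. \<forall>w v. (w, v) \<in> acc (frame M) \<longrightarrow> cint M v c = cint M w c"
    and "forces M w e A" "(w, v) \<in> acc (frame M)"
  shows "forces M v e A"
proof -
  have tr: "trans (acc (frame M))"
    and dom: "\<And>w v. (w, v) \<in> acc (frame M) \<Longrightarrow> indiv (frame M) w \<subseteq> indiv (frame M) v"
    and int: "\<And>w v p. (w, v) \<in> acc (frame M) \<Longrightarrow> pint M w p \<subseteq> pint M v p"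
    using M partial_order_onD unfolding kripke_model_def kripke_frame_def by blast+
  show ?thesis
    using assms(2-)
  proof (induction A arbitrary: w v e)
    case (Atom p ts)
    have "trm_val (cint M v) e t = trm_val (cint M w) e t" if "t \<in> set ts" for t
      using that Atom.prems(1,3) by - (cases t; force)
    then have "map (trm_val (cint M v) e) ts = map (trm_val (cint M w) e) ts"
      by simp
    then show ?case
      using Atom.prems(2) int[OF Atom.prems(3), of p] by (simp only: forces.simps subset_iff)
  next
    case (Imp A B)
    have "(w, u) \<in> acc (frame M)" if "(v, u) \<in> acc (frame M)" for u
      using tr Imp.prems(3) that by (rule transD)
    with Imp.prems(2) show ?case
      by simp
  next
    case (And A B)
    then show ?case
      using And.IH(1)[OF _ _ And.prems(3)] And.IH(2)[OF _ _ And.prems(3)] by auto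
  next
    case (Or A B)
    then show ?case
      using Or.IH(1)[OF _ _ Or.prems(3)] Or.IH(2)[OF _ _ Or.prems(3)] by auto
  next
    case (All x A)
    have "(w, u) \<in> acc (frame M)" if "(v, u) \<in> acc (frame M)" for u
      using tr All.prems(3) that by (rule transD)
    with All.prems(2) show ?case
      by simp
  next
    case (Ex x A)
    then obtain d where "d \<in> indiv (frame M) w" "forces M w (e(x := d)) A"
      by auto
    moreover from this(2) have "forces M v (e(x := d)) A"
      using Ex.prems(1) by (intro Ex.IH[OF _ _ Ex.prems(3)]) simp
    ultimately show ?case
      using dom[OF Ex.prems(3)] by auto
  qed auto
qed

lemma true_at_mono:
  assumes "kripke_model {} M"
    and "\<forall>c\<in>fm_consts A. \<forall>w v. (w, v) \<in> acc (frame M) \<longrightarrow> cint M v c = cint M w c"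
    and "true_at M w A" "(w, v) \<in> acc (frame M)"
  shows "true_at M v A"
  unfolding true_at_def
proof
  fix e
  have "forces M w e A"
    using assms(3) by (simp add: true_at_def)
  then show "forces M v e A"
    by (rule forces_mono[OF assms(1,2) _ assms(4)])
qed

lemma forces_inst:
  assumes "cint M = (\<lambda>_. i)"
  shows "ground_subst s \<Longrightarrow> forces M w e (inst s A) \<longleftrightarrow> forces M w (\<lambda>x. trm_val i e (s x)) A"
proof (induction A arbitrary: w e s)
  case (Atom p ts)
  have "trm_val i e (inst_trm s t) = trm_val i (\<lambda>x. trm_val i e (s x)) t" for t
    by (cases t) auto
  then show ?case
    by (simp add: assms comp_def)
next
  case (All y A)
  have "(\<lambda>x. trm_val i (e(y := d)) ((s(y := Var y)) x)) = (\<lambda>x. trm_val i e (s x))(y := d)" for d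
  proof
    fix x
    show "trm_val i (e(y := d)) ((s(y := Var y)) x) = ((\<lambda>x. trm_val i e (s x))(y := d)) x"
    proof (cases "s x")
      case (Var z)
      then have "z = x"
        using All.prems unfolding ground_subst_def by (metis trm.distinct(1) trm.inject(1))
      with Var show ?thesis
        by simp
    qed simp
  qed
  then show ?case
    using All.prems by (simp add: All.IH del: fun_upd_apply)
next
  case (Ex y A)
  have "(\<lambda>x. trm_val i (e(y := d)) ((s(y := Var y)) x)) = (\<lambda>x. trm_val i e (s x))(y := d)" for d
  proof
    fix x
    show "trm_val i (e(y := d)) ((s(y := Var y)) x) = ((\<lambda>x. trm_val i e (s x))(y := d)) x"
    proof (cases "s x")
      case (Var z)
      then have "z = x"
        using Ex.prems unfolding ground_subst_def by (metis trm.distinct(1) trm.inject(1))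
      with Var show ?thesis
        by simp
    qed simp
  qed
  then show ?case
    using Ex.prems by (simp add: Ex.IH del: fun_upd_apply)
qed auto

lemma forces_subst1:
  assumes "cint M = (\<lambda>_. i)"
  shows "forces M w e (subst1 x a A) \<longleftrightarrow> forces M w (e(x := i a)) A"
proof -
  have "(\<lambda>y. trm_val i e ((Var(x := Const a)) y)) = e(x := i a)"
    by auto
  then show ?thesis
    by (simp add: subst1_def forces_inst[OF assms] del: fun_upd_apply)
qed

text \<open>
  The position \<open>C\<close> mirrors the world \<open>w\<close> once the formulas asserted in \<open>C\<close> that fail at a world
  above \<open>w\<close> fail there only because that world cannot be told apart from \<open>w\<close>.
\<close>
lemma pos_true_iff_true_at:
  assumes M: "kripke_model {} M" and i: "cint M = (\<lambda>_. i)" and w: "w \<in> worlds (frame M)"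
    and dom: "i ` objs C = indiv (frame M) w"
    and asserted: "\<And>B. B \<in> inst_fms \<Gamma> (objs C) \<Longrightarrow> true_at M w B \<Longrightarrow> B \<in> opp C \<union> prp C"
    and atoms: "\<And>p ts. Atom p ts \<in> inst_fms \<Gamma> (objs C) \<Longrightarrow>
      Atom p ts \<in> opp C \<longleftrightarrow> true_at M w (Atom p ts)"
    and above: "\<And>B u. B \<in> inst_fms \<Gamma> (objs C) \<Longrightarrow> B \<in> opp C \<union> prp C \<Longrightarrow>
      (w, u) \<in> acc (frame M) \<Longrightarrow> \<not> true_at M u B \<Longrightarrow>
      indiv (frame M) u = indiv (frame M) w \<and>
      (\<forall>D\<in>inst_fms \<Gamma> (objs C). true_at M u D \<longleftrightarrow> true_at M w D)"
    and A: "A \<in> inst_fms \<Gamma> (objs C)"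
  shows "pos_true C A \<longleftrightarrow> true_at M w A"
proof -
  let ?F = "inst_fms \<Gamma> (objs C)" and ?acc = "acc (frame M)"
  fix e
  have fr: "kripke_frame (frame M)"
    using M by (simp add: kripke_model_def)
  have sub: "u \<in> worlds (frame M)" "(u, u) \<in> ?acc" if "(w, u) \<in> ?acc" for u
    using fr that partial_order_onD(1,4)[of "worlds (frame M)" ?acc]
    by (auto simp: kripke_frame_def refl_on_def)
  have ww: "(w, w) \<in> ?acc"
    using fr w partial_order_onD(1)[of "worlds (frame M)" ?acc]
    by (auto simp: kripke_frame_def refl_on_def)
  have tr: "true_at M u B \<longleftrightarrow> forces M u e B" if "(w, u) \<in> ?acc" "B \<in> ?F" for u B
    using true_at_closed[OF fr sub(1)[OF that(1)]] that(2) by simp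
  have trq: "true_at M u (subst1 x a B) \<longleftrightarrow> forces M u (e(x := i a)) B"
    if "(w, u) \<in> ?acc" "subst1 x a B \<in> ?F" for u x a B
    using tr[OF that] forces_subst1[OF i] by simp
  show ?thesis
    using A
  proof (induction "height A" arbitrary: A rule: less_induct)
    case less
    note A = less.prems
    show ?case
    proof (cases "A \<in> opp C \<union> prp C")
      case False
      then have "\<not> true_at M w A"
        using asserted A by blast
      moreover have "\<not> pos_true C A"
        using False by (cases A) auto
      ultimately show ?thesis
        by blast
    next
      case True
      show ?thesis
      proof (cases A)
        case Bot
        then show ?thesis
          by (simp add: true_at_def)
      next
        case (Atom p ts)
        then show ?thesis
          using atoms A by simp
      next
        case (Imp B D)
        have F: "B \<in> ?F" "D \<in> ?F"
          using inst_fms_Imp[OF A[unfolded Imp]] .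
        have IH: "pos_true C B \<longleftrightarrow> true_at M w B" "pos_true C D \<longleftrightarrow> true_at M w D"
          using less.hyps F Imp by simp_all
        have "true_at M w A \<longleftrightarrow> (true_at M w B \<longrightarrow> true_at M w D)"
        proof
          assume "true_at M w A"
          then show "true_at M w B \<longrightarrow> true_at M w D"
            using Imp ww tr[OF ww] F A by simp
        next
          assume *: "true_at M w B \<longrightarrow> true_at M w D"
          \<comment> \<open>A world \<open>u\<close> that refutes the implication agrees with
            \<open>w\<close> on both parts by \<open>above\<close>, so the classical implication
            would already fail at \<open>w\<close>.\<close>
          show "true_at M w A"
          proof (rule ccontr)
            assume "\<not> true_at M w A"
            then obtain u where u: "(w, u) \<in> ?acc" "true_at M u B" "\<not> true_at M u D"
              using tr[OF ww A] Imp tr F by auto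
            then have "\<not> true_at M u A"
              using sub(2)[OF u(1)] tr[OF u(1)] Imp F A by auto
            with above[OF A True u(1)] u F * show False
              by blast
          qed
        qed
        then show ?thesis
          using Imp True IH by simp
      next
        case (And B D)
        have F: "B \<in> ?F" "D \<in> ?F"
          using inst_fms_And[OF A[unfolded And]] .
        have IH: "pos_true C B \<longleftrightarrow> true_at M w B" "pos_true C D \<longleftrightarrow> true_at M w D"
          using less.hyps F And by simp_all
        then show ?thesis
          using And True tr[OF ww] F A by simp
      next
        case (Or B D)
        have F: "B \<in> ?F" "D \<in> ?F"
          using inst_fms_Or[OF A[unfolded Or]] .
        have IH: "pos_true C B \<longleftrightarrow> true_at M w B" "pos_true C D \<longleftrightarrow> true_at M w D"
          using less.hyps F Or by simp_all
        then show ?thesis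
          using Or True tr[OF ww] F A by simp
      next
        case (All x B)
        have F: "subst1 x a B \<in> ?F" if "a \<in> objs C" for a
          using inst_fms_All[OF A[unfolded All] that] .
        have IH: "pos_true C (subst1 x a B) \<longleftrightarrow> true_at M w (subst1 x a B)" if "a \<in> objs C" for a
          using less.hyps F[OF that] All by simp
        have "true_at M w A \<longleftrightarrow> (\<forall>a\<in>objs C. true_at M w (subst1 x a B))"
        proof
          assume *: "true_at M w A"
          show "\<forall>a\<in>objs C. true_at M w (subst1 x a B)"
          proof
            fix a
            assume a: "a \<in> objs C"
            then have "i a \<in> indiv (frame M) w"
              using dom by blast
            then have "forces M w (e(x := i a)) B"
              using * ww tr[OF ww A] All by simp
            then show "true_at M w (subst1 x a B)"
              using trq[OF ww F[OF a]] by simp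
          qed
        next
          assume *: "\<forall>a\<in>objs C. true_at M w (subst1 x a B)"
          show "true_at M w A"
          proof (rule ccontr)
            assume "\<not> true_at M w A"
            then obtain u d where u: "(w, u) \<in> ?acc" "d \<in> indiv (frame M) u"
              "\<not> forces M u (e(x := d)) B"
              using tr[OF ww A] All by auto
            then have "\<not> true_at M u A"
              using sub(2)[OF u(1)] tr[OF u(1) A] All by auto
            note eq = above[OF A True u(1) this]
            \<comment> \<open>The domain at \<open>u\<close> is that of \<open>w\<close>, so the
              counterexample \<open>d\<close> has a name \<open>a\<close>, and the instance at
              \<open>a\<close> fails at \<open>w\<close> as well.\<close>
            then have "d \<in> i ` objs C"
              using u(2) dom by simp
            then obtain a where a: "a \<in> objs C" "d = i a"
              by blast
            then have "\<not> true_at M u (subst1 x a B)"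
              using trq[OF u(1) F] u(3) by simp
            with eq * a F show False
              by blast
          qed
        qed
        then show ?thesis
          using All True IH by auto
      next
        case (Ex x B)
        have F: "subst1 x a B \<in> ?F" if "a \<in> objs C" for a
          using inst_fms_Ex[OF A[unfolded Ex] that] .
        have IH: "pos_true C (subst1 x a B) \<longleftrightarrow> true_at M w (subst1 x a B)" if "a \<in> objs C" for a
          using less.hyps F[OF that] Ex by simp
        have "true_at M w A \<longleftrightarrow> (\<exists>a\<in>objs C. true_at M w (subst1 x a B))"
        proof -
          have "true_at M w A \<longleftrightarrow> (\<exists>a\<in>objs C. forces M w (e(x := i a)) B)"
            using tr[OF ww A] Ex by (simp add: dom[symmetric])
          then show ?thesis
            using trq[OF ww F] by blast
        qed
        then show ?thesis
          using Ex True IH by auto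
      qed
    qed
  qed
qed


section \<open>Casari frames\<close>

lemma true_at_casari:
  "true_at M w casari \<longleftrightarrow>
    (\<forall>v. (w, v) \<in> acc (frame M) \<longrightarrow>
      (\<forall>u. (v, u) \<in> acc (frame M) \<longrightarrow> (\<forall>d\<in>indiv (frame M) u.
        \<forall>t. (u, t) \<in> acc (frame M) \<longrightarrow>
          (\<forall>s. (t, s) \<in> acc (frame M) \<longrightarrow> [d] \<in> pint M s () \<longrightarrow>
            (\<forall>r. (s, r) \<in> acc (frame M) \<longrightarrow> (\<forall>d\<in>indiv (frame M) r. [d] \<in> pint M r ()))) \<longrightarrow>
          (\<forall>r. (t, r) \<in> acc (frame M) \<longrightarrow> (\<forall>d\<in>indiv (frame M) r. [d] \<in> pint M r ())))) \<longrightarrow>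
      (\<forall>r. (v, r) \<in> acc (frame M) \<longrightarrow> (\<forall>d\<in>indiv (frame M) r. [d] \<in> pint M r ())))"
  by (simp add: true_at_def casari_def Let_def)

text \<open>Among the worlds above \<open>v\<close> at which the universal formula fails, take a
  maximal one, \<open>m\<close>. Some \<open>d\<close> in the domain of \<open>m\<close> itself
  lacks the predicate there, since all higher worlds are full. A world above \<open>m\<close> with
  the predicate at \<open>d\<close> is then a proper successor, hence full, so the inner hypothesis
  of Casari's formula holds at \<open>m\<close> for \<open>d\<close> and would make \<open>m\<close>
  full.\<close>

lemma finite_frame_in_Cas:
  assumes F: "kripke_frame F" and fin: "finite (worlds F)"
  shows "F \<in> Cas"
proof -
  let ?R = "acc F"
  have refl: "\<And>w. w \<in> worlds F \<Longrightarrow> (w, w) \<in> ?R" and tr: "trans ?R"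
    and sub: "?R \<subseteq> worlds F \<times> worlds F"
    using F partial_order_onD[of "worlds F" ?R] by (auto simp: kripke_frame_def refl_on_def)
  have "true_at M w casari" if M: "frame M = F" and w: "w \<in> worlds F" for M and w
  proof -
    define full where "full v \<longleftrightarrow> (\<forall>r. (v, r) \<in> ?R \<longrightarrow> (\<forall>d\<in>indiv F r. [d] \<in> pint M r ()))" for v
    have "full v" if wv: "(w, v) \<in> ?R"
      and prem: "\<And>u d t. (v, u) \<in> ?R \<Longrightarrow> d \<in> indiv F u \<Longrightarrow> (u, t) \<in> ?R \<Longrightarrow>
        \<forall>s. (t, s) \<in> ?R \<longrightarrow> [d] \<in> pint M s () \<longrightarrow> full s \<Longrightarrow> full t" for v
    proof (rule ccontr)
      assume "\<not> full v"
      moreover have "(v, v) \<in> ?R"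
        using wv sub refl by blast
      moreover have "wf ((?R - Id)\<inverse>)"
        using partial_order_on_acyclic[of "worlds F" ?R] F finite_subset[OF sub] fin
        by (intro finite_acyclic_wf_converse) (simp_all add: kripke_frame_def)
      ultimately obtain m where m: "m \<in> {u. (v, u) \<in> ?R \<and> \<not> full u}"
        and min: "\<And>u. (u, m) \<in> (?R - Id)\<inverse> \<Longrightarrow> u \<notin> {u. (v, u) \<in> ?R \<and> \<not> full u}"
        using wfE_min[of "(?R - Id)\<inverse>" v "{u. (v, u) \<in> ?R \<and> \<not> full u}"] by blast
      have max: "full u" if "(m, u) \<in> ?R" "u \<noteq> m" for u
        using min[of u] that m transD[OF tr, of v m u] by simp
      obtain r d where r: "(m, r) \<in> ?R" "d \<in> indiv F r" "[d] \<notin> pint M r ()"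
        using m unfolding full_def by blast
      moreover have rr: "(r, r) \<in> ?R"
        using r(1) sub refl by blast
      ultimately have "r = m"
        using max unfolding full_def by blast
      then have "\<not> (\<forall>s. (m, s) \<in> ?R \<longrightarrow> [d] \<in> pint M s () \<longrightarrow> full s)"
        using prem[of m d m] m r rr by auto
      then obtain s where "(m, s) \<in> ?R" "[d] \<in> pint M s ()" "\<not> full s"
        by blast
      with max r \<open>r = m\<close> show False
        by blast
    qed
    then show ?thesis
      unfolding true_at_casari M full_def[symmetric] by blast
  qed
  then show ?thesis
    using F by (auto simp: Cas_def frame_valid_def)
qed

text \<open>Along a chain of growing domains Casari's formula is refuted by a predicate that lags
  one step behind: at \<open>f n\<close> it holds of the individuals already present earlier in the
  chain. Each individual of the chain acquires it in the end, yet at no point of the chain does it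
  hold of everything in all higher worlds.\<close>

lemma Cas_wf:
  assumes "F \<in> Cas"
  shows "wf {(u, v). (v, u) \<in> acc F \<and> indiv F v \<subset> indiv F u}"
  unfolding wf_iff_no_infinite_down_chain
proof
  assume "\<exists>f. \<forall>n. (f (Suc n), f n) \<in> {(u, v). (v, u) \<in> acc F \<and> indiv F v \<subset> indiv F u}"
  then obtain f where step: "\<And>n. (f n, f (Suc n)) \<in> acc F"
    and grow: "\<And>n. indiv F (f n) \<subset> indiv F (f (Suc n))"
    unfolding mem_Collect_eq prod.case by blast
  have F: "kripke_frame F"
    using assms by (simp add: Cas_def)
  let ?R = "acc F"
  have refl: "\<And>w. w \<in> worlds F \<Longrightarrow> (w, w) \<in> ?R" and tr: "trans ?R"
    and sub: "?R \<subseteq> worlds F \<times> worlds F"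
    and dom: "\<And>u v. (u, v) \<in> ?R \<Longrightarrow> indiv F u \<subseteq> indiv F v"
    using F partial_order_onD[of "worlds F" ?R] by (auto simp: kripke_frame_def refl_on_def)
  have fw: "f n \<in> worlds F" for n
    using step sub by blast
  have "(f m, f n) \<in> ?R" if "m \<le> n" for m n
    using that
  proof (induction rule: dec_induct)
    case base
    then show ?case
      using fw refl by blast
  next
    case (step n)
    then show ?case
      using \<open>\<And>n. (f n, f (Suc n)) \<in> acc F\<close> transD[OF tr] by blast
  qed
  note chain = this
  define low where "low v \<longleftrightarrow> (\<exists>n. (v, f n) \<in> ?R)" for v
  define lev where "lev v = (LEAST n. (v, f n) \<in> ?R)" for v
  define idx where "idx d = (LEAST n. d \<in> indiv F (f n))" for d
  have lev: "(v, f (lev v)) \<in> ?R" if "low v" for v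
    using that LeastI_ex[of "\<lambda>n. (v, f n) \<in> ?R"] unfolding low_def lev_def by blast
  have idx_le: "idx d \<le> n" if "d \<in> indiv F (f n)" for d n
    unfolding idx_def using that by (rule Least_le)
  \<comment> \<open>Strict growth of the domains is what keeps \<open>f n\<close> from lying below
    an earlier world of the chain.\<close>
  have lev_f: "lev (f n) = n" for n
  proof -
    have "low (f n)"
      using refl fw unfolding low_def by blast
    have "lev (f n) \<le> n"
      unfolding lev_def using refl fw by (intro Least_le) blast
    moreover have "\<not> lev (f n) < n"
    proof
      assume "lev (f n) < n"
      then have "indiv F (f (lev (f n))) \<subset> indiv F (f n)"
        using grow dom[OF chain, of "Suc (lev (f n))" n] by (meson Suc_leI psubset_subset_trans)
      then show False
        using dom[OF lev[OF \<open>low (f n)\<close>]] by blast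
    qed
    ultimately show ?thesis
      by simp
  qed
  have low_down: "low u" if "low v" "(u, v) \<in> ?R" for u v
    using that transD[OF tr] unfolding low_def by blast
  have lev_mono: "lev u \<le> lev v" if "low v" "(u, v) \<in> ?R" for u v
    unfolding lev_def[of u] using lev[OF that(1)] that(2) transD[OF tr] by (blast intro: Least_le)
  \<comment> \<open>The strict comparison creates the lag. Worlds below no member of the chain get
    the predicate everywhere, which is compatible with persistence because the worlds below the
    chain are closed downward.\<close>
  define I where "I v = {[d] |d. d \<in> indiv F v \<and> (low v \<longrightarrow> idx d < lev v)}" for v
  define M :: "('a, 'b, unit, unit) kmodel" where
    "M = \<lparr>frame = F, cint = (\<lambda>_ _. undefined), pint = (\<lambda>v _. I v)\<rparr>"
  have sel: "frame M = F" "pint M = (\<lambda>v _. I v)"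
    by (simp_all add: M_def)
  have "I u \<subseteq> I v" if "(u, v) \<in> ?R" for u v
  proof
    fix l
    assume "l \<in> I u"
    then obtain d where d: "l = [d]" "d \<in> indiv F u" "low u \<longrightarrow> idx d < lev u"
      unfolding I_def by blast
    have "low v \<longrightarrow> idx d < lev v"
      using d(3) low_down[OF _ that] lev_mono[OF _ that] by fastforce
    with d(1,2) dom[OF that] show "l \<in> I v"
      unfolding I_def by blast
  qed
  then have "kripke_model {} M"
    using F unfolding kripke_model_def M_def by (auto simp: I_def)
  moreover have "fm_consts casari = {}"
    by (simp add: casari_def Let_def)
  ultimately have cas: "true_at M (f 0) casari"
    using assms fw unfolding Cas_def frame_valid_def by (auto simp: M_def)
  define full where "full v \<longleftrightarrow> (\<forall>r. (v, r) \<in> ?R \<longrightarrow> (\<forall>d\<in>indiv F r. [d] \<in> I r))" for v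
  have *: "(\<forall>v. (f 0, v) \<in> ?R \<longrightarrow> (\<forall>u. (v, u) \<in> ?R \<longrightarrow> (\<forall>d\<in>indiv F u.
        \<forall>t. (u, t) \<in> ?R \<longrightarrow> (\<forall>s. (t, s) \<in> ?R \<longrightarrow> [d] \<in> I s \<longrightarrow> full s) \<longrightarrow> full t)) \<longrightarrow> full v)"
    using cas unfolding true_at_casari sel full_def .
  have not_full: "\<not> full (f n)" for n
  proof -
    obtain d where d: "d \<in> indiv F (f (Suc n))" "d \<notin> indiv F (f n)"
      using grow[of n] by blast
    have "\<not> idx d < Suc n"
    proof
      assume "idx d < Suc n"
      moreover have "d \<in> indiv F (f (idx d))"
        using d(1) unfolding idx_def by (rule LeastI)
      ultimately show False
        using d(2) dom[OF chain, of "idx d" n] by auto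
    qed
    moreover have "low (f (Suc n))"
      using refl fw unfolding low_def by blast
    ultimately have "[d] \<notin> I (f (Suc n))"
      using lev_f by (auto simp: I_def)
    with d(1) step show ?thesis
      unfolding full_def by blast
  qed
  \<comment> \<open>Below the chain the last assumption cannot hold: \<open>d\<close> gains the
    predicate one step beyond the level of \<open>t\<close>, at a world that is still not full.
    Elsewhere \<open>full t\<close> is immediate.\<close>
  have "full t" if "d \<in> indiv F u" "(u, t) \<in> ?R" "\<forall>s. (t, s) \<in> ?R \<longrightarrow> [d] \<in> I s \<longrightarrow> full s" for u d t
  proof (cases "low t")
    case True
    let ?s = "f (Suc (lev t))"
    have "(t, ?s) \<in> ?R"
      using lev[OF True] step transD[OF tr] by blast
    moreover have "d \<in> indiv F (f (lev t))"
      using that(1) dom[OF that(2)] dom[OF lev[OF True]] by blast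
    then have "[d] \<in> I ?s"
      using idx_le[of d "lev t"] dom[OF step] lev_f by (auto simp: I_def less_Suc_eq_le)
    ultimately show ?thesis
      using that(3) not_full by blast
  next
    case False
    then show ?thesis
      using low_down unfolding full_def I_def by blast
  qed
  then have "full (f 0)"
    using mp[OF spec[OF *, of "f 0"]] refl[OF fw] by blast
  with not_full show False
    by blast
qed

section \<open>Opponent defeats Proponent along a countermodel\<close>

lemma fin_plays_nonempty: "h \<in> fin_plays \<Gamma> C \<Longrightarrow> h \<noteq> []"
  by (induction rule: fin_plays.induct) auto

lemma ended_snoc: "h \<noteq> [] \<Longrightarrow> ended (h @ [C]) \<longleftrightarrow> prp_turn C = prp_turn (last h)"
  by (cases h) (auto simp: ended_def)

lemma follows_snoc:
  assumes "h \<noteq> []"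
  shows "follows \<sigma> (h @ [C]) \<longleftrightarrow> follows \<sigma> h \<and> (prp_turn (last h) \<longrightarrow> C = \<sigma> h)"
proof -
  obtain n where n: "length h = Suc n"
    using assms by (cases h) auto
  have last: "last h = h ! n"
    using assms n by (simp add: last_conv_nth)
  let ?ok = "\<lambda>g i. prp_turn (g ! i) \<longrightarrow> g ! Suc i = \<sigma> (take (Suc i) g)"
  have "follows \<sigma> (h @ [C]) \<longleftrightarrow> (\<forall>i<Suc n. ?ok (h @ [C]) i)"
    unfolding follows_def by (auto simp: n)
  also have "\<dots> \<longleftrightarrow> (\<forall>i<n. ?ok (h @ [C]) i) \<and> ?ok (h @ [C]) n"
    unfolding All_less_Suc by (rule conj_commute)
  also have "(\<forall>i<n. ?ok (h @ [C]) i) \<longleftrightarrow> follows \<sigma> h"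
    unfolding follows_def by (auto simp: n nth_append)
  also have "?ok (h @ [C]) n \<longleftrightarrow> (prp_turn (last h) \<longrightarrow> C = \<sigma> h)"
    by (simp add: n last nth_append)
  finally show ?thesis .
qed

lemma follows_singleton: "follows \<sigma> [C]"
  by (simp add: follows_def)

text \<open>\<open>kripke_model {}\<close> leaves \<open>cint M\<close> unconstrained. What objects
  denote is given instead by a map \<open>i\<close>, which is revised during the play as new objects
  receive individuals.\<close>

locale fin_countermodel =
  fixes M :: "('w, 'd, 'p, 'a) kmodel" and \<Gamma> :: "('p, 'a) fm set"
  assumes infinite_objects: "infinite (UNIV :: 'a set)"
    and finite_\<Gamma>: "finite \<Gamma>"
    and model: "kripke_model {} M"
    and finCas: "frame M \<in> finCas"
begin

abbreviation W where "W \<equiv> worlds (frame M)"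
abbreviation R where "R \<equiv> acc (frame M)"
abbreviation D where "D \<equiv> indiv (frame M)"

text \<open>\<open>i\<close> need not be injective: distinct constants of the game can denote the same individual.\<close>
definition truth :: "('a \<Rightarrow> 'd) \<Rightarrow> 'w \<Rightarrow> ('p, 'a) fm \<Rightarrow> bool" where
  "truth i w A \<longleftrightarrow> true_at (M\<lparr>cint := \<lambda>_. i\<rparr>) w A"

lemma frame: "kripke_frame (frame M)"
  using model by (simp add: kripke_model_def)

lemma R_refl: "w \<in> W \<Longrightarrow> (w, w) \<in> R" and R_trans: "(u, v) \<in> R \<Longrightarrow> (v, w) \<in> R \<Longrightarrow> (u, w) \<in> R"
  and R_worlds: "(u, v) \<in> R \<Longrightarrow> v \<in> W" and D_mono: "(u, v) \<in> R \<Longrightarrow> D u \<subseteq> D v"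
  using frame partial_order_onD[of W R] unfolding kripke_frame_def refl_on_def trans_def by blast+

lemma D_finite: "w \<in> W \<Longrightarrow> finite (D w)"
  using finCas by (simp add: finCas_def)

lemma model_cint: "kripke_model {} (M\<lparr>cint := \<lambda>_. i\<rparr>)"
  using model by (simp add: kripke_model_def)

lemma truth_mono: "truth i w A \<Longrightarrow> (w, v) \<in> R \<Longrightarrow> truth i v A"
  unfolding truth_def using true_at_mono[OF model_cint, of A i w v] by simp

lemma truth_cong:
  assumes "w \<in> W" "\<And>c. c \<in> fm_consts A \<Longrightarrow> i c = j c"
  shows "truth i w A \<longleftrightarrow> truth j w A"
proof -
  have "forces (M\<lparr>cint := \<lambda>_. i\<rparr>) w e A \<longleftrightarrow> forces (M\<lparr>cint := \<lambda>_. j\<rparr>) w e A" for e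
    by (rule forces_cong) (use frame assms in simp_all)
  then show ?thesis
    by (simp add: truth_def true_at_def)
qed

text \<open>The invariant of Opponent's play. Asking only for some failing formula of Proponent
  makes it stable under anything Proponent adds; asking only that the named individuals lie in the
  domain lets it hold at the start, when only the constants are names.\<close>

definition refuted :: "('a \<Rightarrow> 'd) \<Rightarrow> 'w \<Rightarrow> ('p, 'a) position \<Rightarrow> bool" where
  "refuted i w C \<longleftrightarrow> w \<in> W \<and> finite (objs C) \<and> (\<Union>G\<in>\<Gamma>. fm_consts G) \<subseteq> objs C \<and>
     i ` objs C \<subseteq> D w \<and>
     opp C \<subseteq> inst_fms \<Gamma> (objs C) \<and> prp C \<subseteq> inst_fms \<Gamma> (objs C) \<and>
     (\<forall>A\<in>opp C. truth i w A) \<and> (\<exists>A\<in>prp C. \<not> truth i w A)"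

text \<open>
  Opponent moves to a world that still refutes Proponent and has, among these, a maximal domain
  and a maximal theory, and then asserts everything that is true there.
\<close>
lemma opponent_reply:
  assumes ref: "refuted i w C"
  shows "\<exists>v j C'. (w, v) \<in> R \<and> fin_opp_move \<Gamma> C C' \<and> refuted j v C' \<and> prp_turn C' \<and>
    j ` objs C' = D v \<and> prp C' = prp C \<and> (D v = i ` objs C \<longrightarrow> objs C' = objs C)"
proof -
  have w: "w \<in> W" and fin: "finite (objs C)" and cs: "(\<Union>G\<in>\<Gamma>. fm_consts G) \<subseteq> objs C"
    and i_dom: "i ` objs C \<subseteq> D w"
    and oppF: "opp C \<subseteq> inst_fms \<Gamma> (objs C)" and prpF: "prp C \<subseteq> inst_fms \<Gamma> (objs C)"
    and opp: "\<And>A. A \<in> opp C \<Longrightarrow> truth i w A" and bad_w: "\<exists>A\<in>prp C. \<not> truth i w A"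
    using ref unfolding refuted_def by blast+
  define Q where "Q = {u. (w, u) \<in> R \<and> (\<exists>A\<in>prp C. \<not> truth i u A)}"
  have "w \<in> Q"
    using bad_w R_refl[OF w] by (simp add: Q_def)
  moreover have "frame M \<in> Cas"
    using finCas by (simp add: finCas_def)
  \<comment> \<open>\<open>Cas_wf\<close> provides a world of \<open>Q\<close> above which no world
    of \<open>Q\<close> has a larger domain.\<close>
  ultimately obtain v1 where v1: "v1 \<in> Q"
    and "\<And>y. (y, v1) \<in> {(u, v). (v, u) \<in> R \<and> D v \<subset> D u} \<Longrightarrow> y \<notin> Q"
    using wfE_min[OF Cas_wf, of "frame M" w Q] by blast
  then have dom1: "D u = D v1" if "u \<in> Q" "(v1, u) \<in> R" for u
    using that D_mono[of v1 u] by auto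
  have wv1: "(w, v1) \<in> R" and v1W: "v1 \<in> W"
    using v1 R_worlds by (auto simp: Q_def)
  \<comment> \<open>The individuals still without a name; fresh objects \<open>E\<close> are put in
    bijection with them. Finiteness of the domain makes this a legal move in the finite
    variation.\<close>
  define X where "X = D v1 - i ` objs C"
  have finX: "finite X"
    using D_finite[OF v1W] by (simp add: X_def)
  have "infinite (UNIV - objs C)"
    using infinite_objects fin by (rule Diff_infinite_finite[rotated])
  then obtain E where E: "finite E" "card E = card X" "E \<subseteq> UNIV - objs C"
    using infinite_arbitrarily_large by blast
  obtain g where g: "bij_betw g E X"
    using finite_same_card_bij[OF E(1) finX E(2)] by blast
  define j where "j a = (if a \<in> objs C then i a else g a)" for a
  define \<Delta> where "\<Delta> = objs C \<union> E"
  have "j ` E = X"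
    using E(3) bij_betw_imp_surj_on[OF g] by (auto simp: j_def)
  moreover have "j ` objs C = i ` objs C"
    by (simp add: j_def)
  ultimately have j\<Delta>: "j ` \<Delta> = D v1"
    using i_dom D_mono[OF wv1] by (auto simp: \<Delta>_def X_def image_Un)
  have fin\<Delta>: "finite \<Delta>" and C\<Delta>: "objs C \<subseteq> \<Delta>"
    using fin E(1) by (auto simp: \<Delta>_def)
  have finF: "finite (inst_fms \<Gamma> \<Delta>)"
    using finite_inst_fms[OF finite_\<Gamma> fin\<Delta>] .
  have subF: "inst_fms \<Gamma> (objs C) \<subseteq> inst_fms \<Gamma> \<Delta>"
    using inst_fms_mono[OF C\<Delta>] .
  \<comment> \<open>On the old objects \<open>j\<close> coincides with \<open>i\<close>, so formulas
    over them keep their truth value.\<close>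
  have agree: "truth j u A \<longleftrightarrow> truth i u A" if "A \<in> inst_fms \<Gamma> (objs C)" "u \<in> W" for A u
    using inst_fms_consts[OF that(1) cs] by (intro truth_cong[OF that(2)]) (auto simp: j_def)
  define Th where "Th u = {A \<in> inst_fms \<Gamma> \<Delta>. truth j u A}" for u
  have "\<exists>v. (v \<in> Q \<and> (v1, v) \<in> R) \<and> (\<forall>u. u \<in> Q \<and> (v1, u) \<in> R \<longrightarrow> card (Th u) \<le> card (Th v))"
  proof (rule ex_has_greatest_nat)
    show "v1 \<in> Q \<and> (v1, v1) \<in> R"
      using v1 R_refl[OF v1W] by simp
    show "\<forall>u. u \<in> Q \<and> (v1, u) \<in> R \<longrightarrow> card (Th u) < Suc (card (inst_fms \<Gamma> \<Delta>))"
      using finF by (auto simp: Th_def less_Suc_eq_le intro!: card_mono)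
  qed
  then obtain v where v: "v \<in> Q" "(v1, v) \<in> R"
    and max: "\<And>u. u \<in> Q \<Longrightarrow> (v1, u) \<in> R \<Longrightarrow> card (Th u) \<le> card (Th v)"
    by blast
  have wv: "(w, v) \<in> R" and vW: "v \<in> W"
    using v R_worlds by (auto simp: Q_def)
  have Dv: "D v = D v1"
    using dom1 v by blast
  define C' where "C' = C\<lparr>opp := opp C \<union> Th v, objs := \<Delta>\<rparr>"
  have C'_simps: "objs C' = \<Delta>" "prp C' = prp C"
    by (simp_all add: C'_def)
  have "opp C \<subseteq> Th v"
  proof
    fix A
    assume A: "A \<in> opp C"
    then have "truth i v A"
      using opp truth_mono wv by blast
    then show "A \<in> Th v"
      using A oppF subF agree vW by (auto simp: Th_def)
  qed
  then have oppC': "opp C' = Th v"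
    by (auto simp: C'_def)
  have bad_v: "\<exists>A\<in>prp C. \<not> truth j v A"
    using v(1) prpF agree[OF _ vW] unfolding Q_def by blast
  have pos: "pos_true C' A \<longleftrightarrow> truth j v A" if "A \<in> inst_fms \<Gamma> \<Delta>" for A
    unfolding truth_def
  proof (rule pos_true_iff_true_at[OF model_cint, where i = j and \<Gamma> = \<Gamma>])
    show "A \<in> inst_fms \<Gamma> (objs C')"
      using that C'_simps by simp
    show "j ` objs C' = indiv (frame (M\<lparr>cint := \<lambda>_. j\<rparr>)) v"
      using C'_simps j\<Delta> Dv by simp
  next
    fix B u
    assume B: "B \<in> inst_fms \<Gamma> (objs C')" "B \<in> opp C' \<union> prp C'"
      and vu: "(v, u) \<in> acc (frame (M\<lparr>cint := \<lambda>_. j\<rparr>))" and "\<not> true_at (M\<lparr>cint := \<lambda>_. j\<rparr>) u B"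
    then have vu: "(v, u) \<in> R" and Bu: "\<not> truth j u B"
      by (simp_all add: truth_def)
    have uW: "u \<in> W" and wu: "(w, u) \<in> R" and v1u: "(v1, u) \<in> R"
      using R_worlds[OF vu] R_trans[OF wv vu] R_trans[OF v(2) vu] by auto
    \<comment> \<open>Opponent's formulas hold at \<open>v\<close> and persist to \<open>u\<close>,
      so \<open>B\<close> belongs to Proponent and its failure puts \<open>u\<close> into
      \<open>Q\<close>, where the maximality of \<open>v\<close> applies.\<close>
    have "B \<notin> opp C'"
      using Bu truth_mono[OF _ vu] by (auto simp: oppC' Th_def)
    then have "B \<in> prp C"
      using B(2) by (simp add: C'_simps)
    moreover from this have "\<not> truth i u B"
      using Bu agree uW prpF by blast
    ultimately have u: "u \<in> Q"
      using wu by (auto simp: Q_def)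
    have "Th v = Th u"
    proof (rule card_seteq)
      show "finite (Th u)"
        using finF by (simp add: Th_def)
      show "Th v \<subseteq> Th u"
        using truth_mono[OF _ vu] by (auto simp: Th_def)
      show "card (Th u) \<le> card (Th v)"
        using max[OF u v1u] .
    qed
    then have "truth j u B' \<longleftrightarrow> truth j v B'" if "B' \<in> inst_fms \<Gamma> \<Delta>" for B'
      using that unfolding Th_def by blast
    moreover have "D u = D v"
      using dom1[OF u v1u] Dv by simp
    ultimately show "indiv (frame (M\<lparr>cint := \<lambda>_. j\<rparr>)) u = indiv (frame (M\<lparr>cint := \<lambda>_. j\<rparr>)) v \<and>
        (\<forall>B\<in>inst_fms \<Gamma> (objs C'). true_at (M\<lparr>cint := \<lambda>_. j\<rparr>) u B \<longleftrightarrow> true_at (M\<lparr>cint := \<lambda>_. j\<rparr>) v B)"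
      by (simp add: truth_def C'_simps)
  qed (use vW in \<open>auto simp: oppC' Th_def truth_def C'_simps\<close>)
  have "prp_turn C'"
  proof -
    have "opp_mistakes C' = {}"
      using pos by (auto simp: opp_mistakes_def oppC' Th_def)
    moreover have "prp_mistakes C' \<noteq> {}"
      using pos bad_v prpF subF by (fastforce simp: prp_mistakes_def C'_simps)
    ultimately show ?thesis
      by (simp add: prp_turn_def)
  qed
  moreover have "fin_opp_move \<Gamma> C C'"
    unfolding fin_opp_move_def C'_def
    by (intro exI[of _ E] exI[of _ "Th v"]) (use E(1) in \<open>auto simp: Th_def \<Delta>_def\<close>)
  moreover have "refuted j v C'"
    unfolding refuted_def C'_simps oppC'
    using vW fin\<Delta> cs C\<Delta> j\<Delta> Dv prpF subF bad_v by (auto simp: Th_def)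
  \<comment> \<open>Otherwise the objects could increase while the domain stands still, and the
    count of unasserted instances in \<open>not_lost\<close> would not descend.\<close>
  moreover have "\<Delta> = objs C" if "D v = i ` objs C"
  proof -
    have "X = {}"
      using that Dv by (simp add: X_def)
    then have "E = {}"
      using E by simp
    then show ?thesis
      by (simp add: \<Delta>_def)
  qed
  ultimately show ?thesis
    using wv j\<Delta> Dv C'_simps by metis
qed

section \<open>Playing the countermodel against a winning strategy\<close>

context
  fixes C\<^sub>0 :: "('p, 'a) position" and \<sigma>
  assumes win: "prp_winning_strategy \<Gamma> C\<^sub>0 \<sigma>"
begin

definition live :: "('p, 'a) position list \<Rightarrow> bool" where
  "live h \<longleftrightarrow> h \<in> fin_plays \<Gamma> C\<^sub>0 \<and> follows \<sigma> h \<and> \<not> ended h"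

text \<open>If the turn stayed with Proponent after the move, Proponent would have lost, which a
  winning strategy excludes. Hence the move changes the position, and all it can change is
  \<open>prp\<close>, so it adds a formula.\<close>

lemma proponent_step:
  assumes "live h" "prp_turn (last h)" "refuted i w (last h)"
  shows "live (h @ [\<sigma> h])" "\<not> prp_turn (\<sigma> h)" "refuted i w (\<sigma> h)"
    "objs (\<sigma> h) = objs (last h)" "prp (last h) \<subset> prp (\<sigma> h)"
proof -
  have h: "h \<in> fin_plays \<Gamma> C\<^sub>0" "follows \<sigma> h" "\<not> ended h" "h \<noteq> []"
    using assms(1) fin_plays_nonempty by (auto simp: live_def)
  have mv: "prp_move \<Gamma> (last h) (\<sigma> h)"
    using win h assms(2) by (auto simp: prp_winning_strategy_def prp_strategy_def)
  then obtain N where N: "N \<subseteq> inst_fms \<Gamma> (objs (last h))"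
    "\<sigma> h = (last h)\<lparr>prp := prp (last h) \<union> N\<rparr>"
    by (auto simp: prp_move_def)
  have play: "h @ [\<sigma> h] \<in> fin_plays \<Gamma> C\<^sub>0"
    using h mv assms(2) by (auto intro!: fin_plays.move simp: fin_move_def)
  have fol: "follows \<sigma> (h @ [\<sigma> h])"
    using h by (simp add: follows_snoc)
  show turn: "\<not> prp_turn (\<sigma> h)"
  proof
    assume "prp_turn (\<sigma> h)"
    moreover from this have "ended (h @ [\<sigma> h])"
      using ended_snoc[OF h(4)] assms(2) by simp
    ultimately show False
      using win play fol by (auto simp: prp_winning_strategy_def)
  qed
  then show "live (h @ [\<sigma> h])"
    using play fol assms(2) by (simp add: live_def ended_snoc[OF h(4)])
  show "refuted i w (\<sigma> h)" "objs (\<sigma> h) = objs (last h)"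
    using assms(3) N by (auto simp: refuted_def)
  have "prp (\<sigma> h) \<noteq> prp (last h)"
  proof
    assume "prp (\<sigma> h) = prp (last h)"
    then have "\<sigma> h = last h"
      using N(2) by simp
    with turn assms(2) show False
      by simp
  qed
  then show "prp (last h) \<subset> prp (\<sigma> h)"
    using N(2) by auto
qed

lemma opponent_step:
  assumes "live h" "\<not> prp_turn (last h)" "refuted i w (last h)"
  shows "\<exists>v j C'. (w, v) \<in> R \<and> live (h @ [C']) \<and> refuted j v C' \<and> prp_turn C' \<and>
    j ` objs C' = D v \<and> prp C' = prp (last h) \<and> (D v = i ` objs (last h) \<longrightarrow> objs C' = objs (last h))"
proof -
  have h: "h \<in> fin_plays \<Gamma> C\<^sub>0" "follows \<sigma> h" "\<not> ended h" "h \<noteq> []"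
    using assms(1) fin_plays_nonempty by (auto simp: live_def)
  obtain v j C' where *: "(w, v) \<in> R" "fin_opp_move \<Gamma> (last h) C'" "refuted j v C'" "prp_turn C'"
    "j ` objs C' = D v" "prp C' = prp (last h)" "D v = i ` objs (last h) \<longrightarrow> objs C' = objs (last h)"
    using opponent_reply[OF assms(3)] by blast
  have "h @ [C'] \<in> fin_plays \<Gamma> C\<^sub>0"
    using h * assms(2) by (auto intro!: fin_plays.move simp: fin_move_def)
  moreover have "follows \<sigma> (h @ [C'])" "\<not> ended (h @ [C'])"
    using h *(4) assms(2) by (simp_all add: follows_snoc ended_snoc)
  ultimately have "live (h @ [C'])"
    by (simp add: live_def)
  with * show ?thesis
    by blast
qed

text \<open>The state after each reply of Opponent. Because all of \<open>D w\<close> is named, a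
  later world with the same domain calls for no new objects, which is how \<open>round\<close>
  compares positions.\<close>

definition lost :: "('p, 'a) position list \<Rightarrow> ('a \<Rightarrow> 'd) \<Rightarrow> 'w \<Rightarrow> bool" where
  "lost h i w \<longleftrightarrow> live h \<and> prp_turn (last h) \<and> refuted i w (last h) \<and> i ` objs (last h) = D w"

lemma round:
  assumes "lost h i w"
  shows "\<exists>h' j v. lost h' j v \<and> (w, v) \<in> R \<and>
    (D v = D w \<longrightarrow> objs (last h') = objs (last h) \<and> prp (last h) \<subset> prp (last h'))"
proof -
  have h: "live h" "prp_turn (last h)" "refuted i w (last h)" "i ` objs (last h) = D w"
    using assms by (simp_all add: lost_def)
  note ps = proponent_step[OF h(1-3)]
  have "\<exists>v j C'. (w, v) \<in> R \<and> live ((h @ [\<sigma> h]) @ [C']) \<and> refuted j v C' \<and> prp_turn C' \<and>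
    j ` objs C' = D v \<and> prp C' = prp (\<sigma> h) \<and> (D v = i ` objs (\<sigma> h) \<longrightarrow> objs C' = objs (\<sigma> h))"
    using opponent_step[of "h @ [\<sigma> h]" i w] ps(1-3) by simp
  then obtain v j C' where *: "(w, v) \<in> R" "live ((h @ [\<sigma> h]) @ [C'])" "refuted j v C'" "prp_turn C'"
    "j ` objs C' = D v" "prp C' = prp (\<sigma> h)" "D v = i ` objs (\<sigma> h) \<longrightarrow> objs C' = objs (\<sigma> h)"
    by blast
  have "lost ((h @ [\<sigma> h]) @ [C']) j v"
    using * by (simp add: lost_def)
  moreover have "D v = D w \<longrightarrow> objs C' = objs (last h) \<and> prp (last h) \<subset> prp C'"
    using * ps(4,5) h(4) by simp
  ultimately show ?thesis
    using *(1) by (metis last_snoc)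
qed

text \<open>Each round descends lexicographically: either the domain grows, which
  \<open>Cas_wf\<close> limits, or the objects stay the same and Proponent has used up at least one
  more of the finitely many instances over them.\<close>

lemma not_lost: "\<not> lost h i w"
proof -
  have cas: "frame M \<in> Cas"
    using finCas by (simp add: finCas_def)
  \<comment> \<open>Quantifying over all \<open>v\<close> above \<open>w\<close> with the same
    domain lets the inner induction climb while the outer induction hypothesis stays tied to
    \<open>w\<close>.\<close>
  have "\<forall>v h i. (w, v) \<in> R \<and> D v = D w \<longrightarrow> \<not> lost h i v" for w
  proof (induction w rule: wf_induct_rule[OF Cas_wf[OF cas]])
    case (1 w)
    have "\<not> lost h i v" if "(w, v) \<in> R" "D v = D w" for v h i
      using that
    proof (induction "card (inst_fms \<Gamma> (objs (last h)) - prp (last h))" arbitrary: v h i rule: less_induct)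
      case less
      show ?case
      proof
        assume "lost h i v"
        then obtain h' j v' where *: "lost h' j v'" "(v, v') \<in> R"
          "D v' = D v \<longrightarrow> objs (last h') = objs (last h) \<and> prp (last h) \<subset> prp (last h')"
          using round by blast
        have wv': "(w, v') \<in> R"
          using less.prems(1) *(2) R_trans by blast
        show False
        proof (cases "D v' = D v")
          case True
          then have eq: "objs (last h') = objs (last h)" "prp (last h) \<subset> prp (last h')"
            using *(3) by blast+
          have ref: "refuted j v' (last h')"
            using *(1) by (simp add: lost_def)
          have "inst_fms \<Gamma> (objs (last h')) - prp (last h') \<subset> inst_fms \<Gamma> (objs (last h)) - prp (last h)"
            using eq ref unfolding refuted_def by auto
          moreover have "finite (inst_fms \<Gamma> (objs (last h)) - prp (last h))"
            using finite_inst_fms[OF finite_\<Gamma>, of "objs (last h)"] eq ref unfolding refuted_def by auto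
          ultimately have "card (inst_fms \<Gamma> (objs (last h')) - prp (last h')) <
              card (inst_fms \<Gamma> (objs (last h)) - prp (last h))"
            by (intro psubset_card_mono)
          then show False
            using less.hyps[of h' v' j] wv' True less.prems(2) *(1) by simp
        next
          case False
          then have "D w \<subset> D v'"
            using D_mono[OF *(2)] less.prems(2) by blast
          moreover have "(v', v') \<in> R"
            using R_refl R_worlds wv' by blast
          ultimately show False
            using 1[of v'] wv' *(1) by blast
        qed
      qed
    qed
    then show ?case
      by blast
  qed
  moreover have "(w, w) \<in> R" if "lost h i w"
    using that R_refl by (simp add: lost_def refuted_def)
  ultimately show ?thesis
    by blast
qed

text \<open>\<open>lost\<close> need not hold at the start, since individuals may lack names; one
  reply of Opponent, preceded by a move of the strategy if Proponent is to move, leads to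
  it.\<close>

lemma not_refuted_start: "\<not> refuted i w C\<^sub>0"
proof
  assume ref: "refuted i w C\<^sub>0"
  have live: "live [C\<^sub>0]"
    by (simp add: live_def fin_plays.start follows_singleton ended_def)
  have "\<exists>h. live h \<and> \<not> prp_turn (last h) \<and> refuted i w (last h)"
  proof (cases "prp_turn C\<^sub>0")
    case True
    then show ?thesis
      using proponent_step(1-3)[OF live, of i w] ref by (intro exI[of _ "[C\<^sub>0] @ [\<sigma> [C\<^sub>0]]"]) simp
  next
    case False
    then show ?thesis
      using live ref by (intro exI[of _ "[C\<^sub>0]"]) simp
  qed
  then obtain h where "live h" "\<not> prp_turn (last h)" "refuted i w (last h)"
    by blast
  from opponent_step[OF this] obtain v j C' where "live (h @ [C'])" "refuted j v C'" "prp_turn C'"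
    "j ` objs C' = D v"
    by blast
  then have "lost (h @ [C']) j v"
    by (simp add: lost_def)
  with not_lost show False
    by blast
qed

end

end

lemma winning_imp_consequence:
  fixes \<O>\<^sub>0 :: "('p, 'a) fm set"
  assumes inf: "infinite (UNIV :: 'a set)"
    and fin: "finite \<O>\<^sub>0"
    and closed: "\<forall>A\<in>\<O>\<^sub>0. closed_fm A" "closed_fm \<phi>"
    and \<Gamma>: "\<Gamma> = \<O>\<^sub>0 \<union> {\<phi>}"
    and \<Delta>\<^sub>0: "\<Delta>\<^sub>0 = (\<Union>A\<in>\<Gamma>. fm_consts A)"
    and win: "prp_winning_strategy \<Gamma> \<lparr>opp = \<O>\<^sub>0, prp = {\<phi>}, objs = \<Delta>\<^sub>0\<rparr> \<sigma>"
  shows "consequence \<O>\<^sub>0 (finCas :: ('w, 'd) kframe set) \<phi>"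
  unfolding consequence_def
proof (intro allI impI ballI)
  fix M :: "('w, 'd, 'p, 'a) kmodel" and w
  assume M: "kripke_model (\<Union>B\<in>\<O>\<^sub>0 \<union> {\<phi>}. fm_consts B) M \<and> frame M \<in> finCas"
    and O: "\<forall>B\<in>\<O>\<^sub>0. \<forall>w\<in>worlds (frame M). true_at M w B" and w: "w \<in> worlds (frame M)"
  have finG: "finite \<Gamma>"
    using fin \<Gamma> by simp
  interpret fin_countermodel M \<Gamma>
    using inf finG M by unfold_locales (auto simp: kripke_model_def)
  let ?i = "cint M w" and ?C = "\<lparr>opp = \<O>\<^sub>0, prp = {\<phi>}, objs = \<Delta>\<^sub>0\<rparr>"
  \<comment> \<open>Interpretations may differ at worlds unrelated to \<open>w\<close>, but above
    \<open>w\<close> the relevant constants keep their values at \<open>w\<close>; so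
    \<open>?i\<close>, used at all worlds, gives the same forcing there.\<close>
  have const: "cint M v c = ?i c" if "(w, v) \<in> acc (frame M)" "c \<in> \<Delta>\<^sub>0" for v c
    using M that unfolding kripke_model_def \<Delta>\<^sub>0 \<Gamma> by metis
  have truth: "truth ?i w A \<longleftrightarrow> true_at M w A" if "A \<in> \<Gamma>" for A
  proof -
    have "fm_consts A \<subseteq> \<Delta>\<^sub>0"
      using that \<Delta>\<^sub>0 by blast
    then have "forces (M\<lparr>cint := \<lambda>_. ?i\<rparr>) w e A \<longleftrightarrow> forces M w e A" for e
      using const by (intro forces_cong[OF frame _ _ w]) auto
    then show ?thesis
      by (simp add: truth_def true_at_def)
  qed
  show "true_at M w \<phi>"
  proof (rule ccontr)
    assume "\<not> true_at M w \<phi>"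
    moreover have "\<forall>A\<in>\<Gamma>. A \<in> inst_fms \<Gamma> \<Delta>\<^sub>0"
      using closed \<Gamma> by (auto intro: closed_in_inst_fms)
    moreover have "finite \<Delta>\<^sub>0"
      using finG \<Delta>\<^sub>0 by simp
    moreover have "?i ` \<Delta>\<^sub>0 \<subseteq> indiv (frame M) w"
      using M w unfolding kripke_model_def \<Delta>\<^sub>0 \<Gamma> by blast
    ultimately have "refuted ?i w ?C"
      using O w truth \<Gamma> \<Delta>\<^sub>0 unfolding refuted_def by auto
    with not_refuted_start[OF win] show False
      by blast
  qed
qed

section \<open>The model of finite trees\<close>

text \<open>A world is encoded as the whole tree of worlds above it, so gluing models under a new
  root is an application of \<open>Node\<close>.\<close>

datatype ('p, 'a) ktree =
  Node (inds: "'a set") (facts: "('p \<times> 'a list) set") (kids: "('p, 'a) ktree list")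

primrec subtrees :: "('p, 'a) ktree \<Rightarrow> ('p, 'a) ktree set" where
  "subtrees (Node X R ts) = insert (Node X R ts) (\<Union>(set (map subtrees ts)))"

primrec tree_ok :: "('p, 'a) ktree \<Rightarrow> bool" where
  "tree_ok (Node X R ts) \<longleftrightarrow> finite X \<and> (\<forall>(p, as)\<in>R. set as \<subseteq> X) \<and>
     (\<forall>t\<in>set ts. X \<subseteq> inds t \<and> R \<subseteq> facts t) \<and> list_all (\<lambda>b. b) (map tree_ok ts)"

lemma subtrees_refl [simp]: "t \<in> subtrees t"
  by (cases t) simp

lemma finite_subtrees [simp]: "finite (subtrees t)"
  by (induction t) auto

lemma subtrees_trans: "s \<in> subtrees t \<Longrightarrow> r \<in> subtrees s \<Longrightarrow> r \<in> subtrees t"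
  by (induction t) auto

text \<open>Size decreases towards the leaves, which is where antisymmetry of the order comes
  from.\<close>

lemma subtrees_size: "s \<in> subtrees t \<Longrightarrow> s = t \<or> size s < size t"
proof (induction t)
  case (Node X R ts)
  show ?case
  proof (cases "s = Node X R ts")
    case False
    then obtain t where t: "t \<in> set ts" "s \<in> subtrees t"
      using Node.prems by auto
    then have "size s \<le> size t"
      using Node.IH[OF t] by auto
    also have "size t < size (Node X R ts)"
      using size_list_estimation'[OF t(1) order_refl, of size] by simp
    finally show ?thesis
      by simp
  qed simp
qed

lemma subtrees_antisym: "s \<in> subtrees t \<Longrightarrow> t \<in> subtrees s \<Longrightarrow> s = t"
  using subtrees_size[of s t] subtrees_size[of t s] by auto

lemma tree_ok_subtrees:
  "tree_ok t \<Longrightarrow> s \<in> subtrees t \<Longrightarrow> tree_ok s \<and> inds t \<subseteq> inds s \<and> facts t \<subseteq> facts s"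
proof (induction t)
  case (Node X R ts)
  show ?case
  proof (cases "s = Node X R ts")
    case True
    then show ?thesis
      using Node.prems(1) by simp
  next
    case False
    then obtain t where t: "t \<in> set ts" "s \<in> subtrees t"
      using Node.prems by auto
    have "tree_ok t" "X \<subseteq> inds t" "R \<subseteq> facts t"
      using Node.prems(1) t(1) by (auto simp: list_all_iff)
    then show ?thesis
      using Node.IH[OF t(1) _ t(2)] by auto
  qed
qed

lemma tree_ok_inds: "tree_ok t \<Longrightarrow> finite (inds t)"
  and tree_ok_facts: "tree_ok t \<Longrightarrow> (p, as) \<in> facts t \<Longrightarrow> set as \<subseteq> inds t"
  by (cases t; auto)+

text \<open>One model contains all well-formed trees, since forcing at a tree depends on its
  subtrees alone. Individuals are the objects of the game and each denotes itself, so the naming map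
  in \<open>pos_true_iff_true_at\<close> becomes the identity.\<close>

definition tree_model :: "(('p, 'a) ktree, 'a, 'p, 'a) kmodel" where
  "tree_model =
     \<lparr>frame = \<lparr>worlds = {t. tree_ok t}, acc = {(t, s). tree_ok t \<and> s \<in> subtrees t}, indiv = inds\<rparr>,
      cint = \<lambda>_ c. c, pint = \<lambda>t p. {as. (p, as) \<in> facts t}\<rparr>"

lemma tree_model_simps [simp]:
  "worlds (frame tree_model) = {t. tree_ok t}"
  "acc (frame tree_model) = {(t, s). tree_ok t \<and> s \<in> subtrees t}"
  "indiv (frame tree_model) = inds"
  "cint tree_model = (\<lambda>_ c. c)"
  "pint tree_model = (\<lambda>t p. {as. (p, as) \<in> facts t})"
  by (simp_all add: tree_model_def)

lemma kripke_model_tree_model: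
  "kripke_model {} (tree_model :: (('p, 'a) ktree, 'a, 'p, 'a) kmodel)"
proof -
  let ?R = "{(t, s :: ('p, 'a) ktree). tree_ok t \<and> s \<in> subtrees t}"
  have "refl_on {t. tree_ok t} ?R"
    by (simp add: refl_on_def)
  moreover have "trans ?R"
    using subtrees_trans by (auto simp: trans_def)
  moreover have "antisym ?R"
    using subtrees_antisym by (auto simp: antisym_def)
  moreover have "?R \<subseteq> {t. tree_ok t} \<times> {t. tree_ok t}"
    using tree_ok_subtrees by auto
  ultimately have "partial_order_on (Collect tree_ok) ?R"
    by (simp add: partial_order_on_def preorder_on_def)
  moreover have "inds t \<subseteq> inds s" "facts t \<subseteq> facts s" if "tree_ok t" "s \<in> subtrees t"
    for t s :: "('p, 'a) ktree"
    using tree_ok_subtrees[OF that] by simp_all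
  moreover have "{as. (p, as) \<in> facts t} \<subseteq> lists (inds t)" if "tree_ok t"
    for t :: "('p, 'a) ktree" and p
    using tree_ok_facts[OF that] by blast
  ultimately show ?thesis
    unfolding kripke_model_def kripke_frame_def by simp blast
qed

text \<open>A local consequence, from truth at \<open>t\<close> to truth at \<open>t\<close>;
  \<open>consequence\<close> assumes \<open>T\<close> at every world instead, and persistence
  bridges the two. Since the objects of the position exist at \<open>t\<close>, a countermodel can
  hang below a root with domain \<open>\<Delta>\<close> as one of its children.\<close>

definition tree_cons :: "'a set \<Rightarrow> ('p, 'a) fm set \<Rightarrow> ('p, 'a) fm \<Rightarrow> bool" where
  "tree_cons \<Delta> T A \<longleftrightarrow> (\<forall>t. tree_ok t \<and> \<Delta> \<subseteq> inds t \<and> (\<forall>B\<in>T. true_at tree_model t B) \<longrightarrow>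
     true_at tree_model t A)"

lemma tree_true_mono: "true_at tree_model t A \<Longrightarrow> tree_ok t \<Longrightarrow> s \<in> subtrees t \<Longrightarrow> true_at tree_model s A"
  using true_at_mono[OF kripke_model_tree_model, of A t s] by simp

lemma true_at_tree_Atom:
  "true_at tree_model t (Atom p (map Const as)) \<longleftrightarrow> (p, as) \<in> facts t"
  by (simp add: true_at_def comp_def)

section \<open>Proponent's strategy of asserting all tree consequences\<close>

definition prp_reply :: "('p, 'a) fm set \<Rightarrow> ('p, 'a) position \<Rightarrow> ('p, 'a) position" where
  "prp_reply \<Gamma> C = C\<lparr>prp := prp C \<union> {A \<in> inst_fms \<Gamma> (objs C). tree_cons (objs C) (opp C) A}\<rparr>"

definition sound_position :: "('p, 'a) fm set \<Rightarrow> ('p, 'a) position \<Rightarrow> bool" where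
  "sound_position \<Gamma> C \<longleftrightarrow> finite (objs C) \<and> (\<Union>G\<in>\<Gamma>. fm_consts G) \<subseteq> objs C \<and>
     opp C \<subseteq> inst_fms \<Gamma> (objs C) \<and> prp C \<subseteq> inst_fms \<Gamma> (objs C) \<and>
     (\<forall>A\<in>prp C. tree_cons (objs C) (opp C) A)"

text \<open>
  Countermodels to the formulas that are not consequences are glued under a new root, which carries
  the objects of the position and the atoms asserted by Opponent.
\<close>
lemma prp_reply_turn:
  assumes sound: "sound_position \<Gamma> C" and fin: "finite \<Gamma>"
  shows "\<not> prp_turn (prp_reply \<Gamma> C)"
proof
  assume turn: "prp_turn (prp_reply \<Gamma> C)"
  define C' where "C' = prp_reply \<Gamma> C"
  define N where "N = {A \<in> inst_fms \<Gamma> (objs C). tree_cons (objs C) (opp C) A}"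
  let ?F = "inst_fms \<Gamma> (objs C)"
  have finD: "finite (objs C)" and cs: "(\<Union>G\<in>\<Gamma>. fm_consts G) \<subseteq> objs C" and oppF: "opp C \<subseteq> ?F"
    and prpN: "prp C \<subseteq> N"
    using sound unfolding sound_position_def N_def by auto
  have oppN: "opp C \<subseteq> N"
    using oppF by (auto simp: N_def tree_cons_def)
  have C': "objs C' = objs C" "opp C' = opp C" "prp C' = N"
    using prpN by (auto simp: C'_def prp_reply_def N_def)
  have "\<exists>t. tree_ok t \<and> objs C \<subseteq> inds t \<and> (\<forall>B\<in>opp C. true_at tree_model t B) \<and>
      \<not> true_at tree_model t A" if "A \<in> ?F - N" for A
    using that by (auto simp: N_def tree_cons_def)
  \<comment> \<open>One countermodel for each instance that is not a consequence. There are finitely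
    many such instances, so the countermodels can be the children of a single node.\<close>
  then obtain T where T: "\<And>A. A \<in> ?F - N \<Longrightarrow> tree_ok (T A) \<and> objs C \<subseteq> inds (T A) \<and>
      (\<forall>B\<in>opp C. true_at tree_model (T A) B) \<and> \<not> true_at tree_model (T A) A"
    by metis
  have "finite (T ` (?F - N))"
    using finite_inst_fms[OF fin finD] by simp
  then obtain ts where ts: "set ts = T ` (?F - N)"
    using finite_list[of "T ` (?F - N)"] by blast
  define R where "R = {(p, as). Atom p (map Const as) \<in> opp C}"
  define r where "r = Node (objs C) R ts"
  have kid: "tree_ok t" "objs C \<subseteq> inds t" "\<And>B. B \<in> opp C \<Longrightarrow> true_at tree_model t B"
    if "t \<in> set ts" for t
    using that ts T by auto
  have r_ok: "tree_ok r"
  proof -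
    have "set as \<subseteq> objs C" if "(p, as) \<in> R" for p as
    proof -
      have "Atom p (map Const as) \<in> ?F"
        using that oppF by (auto simp: R_def)
      from inst_fms_consts[OF this cs] show ?thesis
        by auto
    qed
    moreover have "R \<subseteq> facts t" if "t \<in> set ts" for t
      using kid(3)[OF that] true_at_tree_Atom[of t] by (auto simp: R_def)
    ultimately show ?thesis
      using finD kid(1,2) by (auto simp: r_def list_all_iff)
  qed
  \<comment> \<open>Proper subtrees of \<open>r\<close> lie in countermodels in which Opponent's
    formulas hold, and with them all of \<open>N\<close>. So only \<open>r\<close> itself can refute
    an asserted formula.\<close>
  have above: "true_at tree_model s A" if A: "A \<in> N" and s: "s \<in> subtrees r" "s \<noteq> r" for A s
  proof -
    obtain t where t: "t \<in> set ts" "s \<in> subtrees t"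
      using s by (auto simp: r_def)
    have "true_at tree_model t A"
      using A kid[OF t(1)] by (simp add: N_def tree_cons_def)
    then show ?thesis
      using tree_true_mono kid(1)[OF t(1)] t(2) by blast
  qed
  \<comment> \<open>Such a formula fails in its own countermodel, which lies above
    \<open>r\<close>.\<close>
  have outside: "\<not> true_at tree_model r A" if "A \<in> ?F - N" for A
  proof
    assume "true_at tree_model r A"
    moreover have "T A \<in> set ts"
      using that ts by blast
    then have "T A \<in> subtrees r"
      unfolding r_def by (auto intro: subtrees_refl)
    ultimately have "true_at tree_model (T A) A"
      using tree_true_mono r_ok by blast
    with T[OF that] show False
      by blast
  qed
  have pos: "pos_true C' A \<longleftrightarrow> true_at tree_model r A" if "A \<in> ?F" for A
  proof (rule pos_true_iff_true_at[OF kripke_model_tree_model, where i = "\<lambda>c. c" and \<Gamma> = \<Gamma>])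
    show "A \<in> inst_fms \<Gamma> (objs C')"
      using that C' by simp
    show "(\<lambda>c. c) ` objs C' = indiv (frame tree_model) r"
      by (simp add: C' r_def)
    fix B
    assume "B \<in> inst_fms \<Gamma> (objs C')" "true_at tree_model r B"
    then show "B \<in> opp C' \<union> prp C'"
      using outside C' by auto
  next
    fix p us
    assume "Atom p us \<in> inst_fms \<Gamma> (objs C')"
    then obtain as where "us = map Const as"
      using closed_Atom_args[of p us] inst_fms_closed by blast
    then show "Atom p us \<in> opp C' \<longleftrightarrow> true_at tree_model r (Atom p us)"
      by (simp add: true_at_tree_Atom C' r_def R_def)
  next
    fix B u
    assume "B \<in> opp C' \<union> prp C'" "(r, u) \<in> acc (frame tree_model)" "\<not> true_at tree_model u B"
    then have "u = r"
      using above[of B u] C' oppN by auto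
    then show "indiv (frame tree_model) u = indiv (frame tree_model) r \<and>
        (\<forall>B\<in>inst_fms \<Gamma> (objs C'). true_at tree_model u B \<longleftrightarrow> true_at tree_model r B)"
      by simp
  qed (use r_ok in simp_all)
  have "opp_mistakes C' = {}" "prp_mistakes C' \<noteq> {}"
    using turn by (simp_all add: C'_def prp_turn_def)
  then have "\<forall>A\<in>opp C. true_at tree_model r A" and "\<exists>A\<in>N. \<not> true_at tree_model r A"
    using pos oppF C' by (auto simp: opp_mistakes_def prp_mistakes_def N_def)
  moreover have "objs C \<subseteq> inds r"
    by (simp add: r_def)
  \<comment> \<open>The tree \<open>r\<close> is itself among those over which
    \<open>tree_cons\<close> quantifies, so it cannot refute a member of \<open>N\<close>.\<close>
  ultimately show False
    using r_ok unfolding N_def tree_cons_def by blast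
qed

text \<open>Opponent only adds assumptions and objects, so whatever Proponent has asserted as a
  consequence stays one.\<close>

lemma tree_cons_mono: "tree_cons \<Delta> T A \<Longrightarrow> \<Delta> \<subseteq> \<Delta>' \<Longrightarrow> T \<subseteq> T' \<Longrightarrow> tree_cons \<Delta>' T' A"
  unfolding tree_cons_def by blast

lemma prp_reply_winning:
  assumes fin: "finite \<Gamma>" and start: "sound_position \<Gamma> C\<^sub>0"
  shows "prp_winning_strategy \<Gamma> C\<^sub>0 (\<lambda>h. prp_reply \<Gamma> (last h))"
proof -
  let ?\<sigma> = "\<lambda>h. prp_reply \<Gamma> (last h)"
  have sound: "sound_position \<Gamma> (last h)" if "h \<in> fin_plays \<Gamma> C\<^sub>0" "follows ?\<sigma> h" for h
    using that
  proof (induction rule: fin_plays.induct)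
    case start
    then show ?case
      using assms(2) by simp
  next
    case (move h C)
    have ne: "h \<noteq> []"
      using move.hyps(1) fin_plays_nonempty by blast
    have fol: "follows ?\<sigma> h" "prp_turn (last h) \<longrightarrow> C = prp_reply \<Gamma> (last h)"
      using move.prems follows_snoc[OF ne, of ?\<sigma> C] by blast+
    have IH: "sound_position \<Gamma> (last h)"
      using move.IH fol(1) .
    show ?case
    proof (cases "prp_turn (last h)")
      case True
      then show ?thesis
        using fol(2) IH by (auto simp: sound_position_def prp_reply_def)
    next
      case False
      then obtain E N where *: "finite E" "N \<subseteq> inst_fms \<Gamma> (objs (last h) \<union> E)"
        "C = (last h)\<lparr>opp := opp (last h) \<union> N, objs := objs (last h) \<union> E\<rparr>"
        using move.hyps(3) by (auto simp: fin_move_def fin_opp_move_def)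
      have "inst_fms \<Gamma> (objs (last h)) \<subseteq> inst_fms \<Gamma> (objs (last h) \<union> E)"
        by (rule inst_fms_mono) simp
      moreover have "tree_cons (objs (last h) \<union> E) (opp (last h) \<union> N) A" if "A \<in> prp (last h)" for A
        using IH that tree_cons_mono[of "objs (last h)" "opp (last h)" A]
        by (auto simp: sound_position_def)
      ultimately show ?thesis
        using IH * by (auto simp: sound_position_def)
    qed
  qed
  have "prp_strategy \<Gamma> C\<^sub>0 ?\<sigma>"
    unfolding prp_strategy_def
  proof (intro ballI impI)
    show "prp_move \<Gamma> (last h) (prp_reply \<Gamma> (last h))" for h
      unfolding prp_move_def
      by (rule exI[of _ "{A \<in> inst_fms \<Gamma> (objs (last h)). tree_cons (objs (last h)) (opp (last h)) A}"])
        (simp add: prp_reply_def)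
  qed
  moreover have "\<not> prp_turn (last h)" if "h \<in> fin_plays \<Gamma> C\<^sub>0" "follows ?\<sigma> h" "ended h" for h
    using that
  proof cases
    case start
    then show ?thesis
      using that(3) by (simp add: ended_def)
  next
    case (move h' C)
    have ne: "h' \<noteq> []"
      using move(2) fin_plays_nonempty by blast
    have fol: "follows ?\<sigma> h'" "prp_turn (last h') \<longrightarrow> C = prp_reply \<Gamma> (last h')"
      using that(2) follows_snoc[OF ne, of ?\<sigma> C] move(1) by blast+
    have turn: "prp_turn C = prp_turn (last h')"
      using that(3) move(1) ended_snoc[OF ne] by simp
    \<comment> \<open>The turn did not change; had it been Proponent's, \<open>C\<close> would be a
      reply that leaves the turn with Proponent, against \<open>prp_reply_turn\<close>.\<close>
    then show ?thesis
      using prp_reply_turn[OF sound[OF move(2) fol(1)] fin] fol(2) move(1) by auto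
  qed
  ultimately show ?thesis
    by (simp add: prp_winning_strategy_def)
qed

section \<open>Copying finite trees into frames over arbitrary infinite types\<close>

lemma finite_inj_on_to_infinite:
  assumes "finite A" "infinite (UNIV :: 'b set)"
  shows "\<exists>f :: 'a \<Rightarrow> 'b. inj_on f A"
proof -
  obtain B :: "'b set" where "finite B" "card B = card A"
    using infinite_arbitrarily_large[OF assms(2)] by blast
  then show ?thesis
    using card_le_inj[OF assms(1)] by (metis order_refl)
qed

text \<open>A tree has finitely many nodes, with finitely many individuals in all, so it can be
  copied along injections into \<open>'w\<close> and \<open>'d\<close>; the copy is a finite frame
  and hence in Casari's class. Truth of \<open>T\<close> at the root persists to the whole copy, so
  \<open>consequence\<close> applies to it.\<close>

lemma consequence_imp_tree_cons:
  fixes T :: "('p, 'a) fm set"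
  assumes inf: "infinite (UNIV :: 'w set)" "infinite (UNIV :: 'd set)"
    and cons: "consequence T (finCas :: ('w, 'd) kframe set) A"
    and closed: "\<forall>B\<in>T. free_vars B = {}" "free_vars A = {}"
  shows "tree_cons (\<Union>B\<in>T \<union> {A}. fm_consts B) T A"
  unfolding tree_cons_def
proof (intro allI impI)
  let ?K = "\<Union>B\<in>T \<union> {A}. fm_consts B"
  fix t :: "('p, 'a) ktree"
  assume "tree_ok t \<and> ?K \<subseteq> inds t \<and> (\<forall>B\<in>T. true_at tree_model t B)"
  then have t: "tree_ok t" "?K \<subseteq> inds t" "\<forall>B\<in>T. true_at tree_model t B"
    by blast+
  let ?S = "subtrees t"
  define X where "X = (\<Union>s\<in>?S. inds s)"
  have ok: "tree_ok s" "inds t \<subseteq> inds s" "inds s \<subseteq> X" if "s \<in> ?S" for s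
    using tree_ok_subtrees[OF t(1) that] that by (auto simp: X_def)
  have "finite X"
    using ok(1) tree_ok_inds by (auto simp: X_def)
  then obtain g :: "'a \<Rightarrow> 'd" where g: "inj_on g X"
    using finite_inj_on_to_infinite inf(2) by blast
  obtain f :: "('p, 'a) ktree \<Rightarrow> 'w" where f: "inj_on f ?S"
    using finite_inj_on_to_infinite[OF finite_subtrees inf(1)] by blast
  define f' where "f' = inv_into ?S f"
  have f': "f' (f s) = s" if "s \<in> ?S" for s
    using f that by (simp add: f'_def)
  define F :: "('w, 'd) kframe" where
    "F = \<lparr>worlds = f ` ?S, acc = {(f s, f r) |s r. s \<in> ?S \<and> r \<in> subtrees s},
      indiv = \<lambda>w. g ` inds (f' w)\<rparr>"
  define M :: "('w, 'd, 'p, 'a) kmodel" where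
    "M = \<lparr>frame = F, cint = \<lambda>_. g, pint = \<lambda>w p. map g ` {as. (p, as) \<in> facts (f' w)}\<rparr>"
  have acc: "(f s, w) \<in> acc F \<longleftrightarrow> (\<exists>r\<in>subtrees s. w = f r)" if "s \<in> ?S" for s w
  proof
    assume "(f s, w) \<in> acc F"
    then obtain s' r where "f s = f s'" "w = f r" "s' \<in> ?S" "r \<in> subtrees s'"
      by (auto simp: F_def)
    moreover from this have "s = s'"
      using inj_onD[OF f] that by blast
    ultimately show "\<exists>r\<in>subtrees s. w = f r"
      by blast
  qed (use that in \<open>auto simp: F_def\<close>)
  have po: "partial_order_on (worlds F) (acc F)"
    unfolding partial_order_on_def preorder_on_def
  proof (intro conjI)
    show "acc F \<subseteq> worlds F \<times> worlds F"
      using subtrees_trans[of _ t] by (auto simp: F_def)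
    show "refl_on (worlds F) (acc F)"
    proof (rule refl_onI)
      fix w
      assume "w \<in> worlds F"
      then obtain s where "s \<in> ?S" "w = f s"
        by (auto simp: F_def)
      then show "(w, w) \<in> acc F"
        using acc[of s w] subtrees_refl by blast
    qed
    show "trans (acc F)"
    proof (rule transI)
      fix u v w
      assume uv: "(u, v) \<in> acc F" and vw: "(v, w) \<in> acc F"
      obtain s r where sr: "u = f s" "v = f r" "s \<in> ?S" "r \<in> subtrees s"
        using uv by (auto simp: F_def)
      then have "r \<in> ?S"
        using subtrees_trans by blast
      then obtain q where "w = f q" "q \<in> subtrees r"
        using vw acc sr(2) by blast
      then show "(u, w) \<in> acc F"
        using sr acc[OF sr(3)] subtrees_trans by blast
    qed
    show "antisym (acc F)"
    proof (rule antisymI)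
      fix u v
      assume uv: "(u, v) \<in> acc F" and vu: "(v, u) \<in> acc F"
      obtain s r where sr: "u = f s" "v = f r" "s \<in> ?S" "r \<in> subtrees s"
        using uv by (auto simp: F_def)
      then have r: "r \<in> ?S"
        using subtrees_trans by blast
      then obtain q where q: "u = f q" "q \<in> subtrees r"
        using vu acc sr(2) by blast
      have "f q = f s"
        using q(1) sr(1) by simp
      then have "q = s"
        using subtrees_trans[OF r q(2)] sr(3) by (rule inj_onD[OF f])
      then have "r = s"
        using sr(4) q(2) by (intro subtrees_antisym) simp_all
      then show "u = v"
        using sr(1,2) by simp
    qed
  qed
  have mono: "inds s \<subseteq> inds r" "facts s \<subseteq> facts r" "r \<in> ?S" if "s \<in> ?S" "r \<in> subtrees s" for s r
    using tree_ok_subtrees[OF ok(1)[OF that(1)] that(2)] subtrees_trans[OF that] by auto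
  have F: "kripke_frame F"
    unfolding kripke_frame_def
  proof (intro conjI allI impI po)
    fix u v
    assume "(u, v) \<in> acc F"
    then obtain s r where "u = f s" "v = f r" "s \<in> ?S" "r \<in> subtrees s"
      by (auto simp: F_def)
    then show "indiv F u \<subseteq> indiv F v"
      using mono[of s r] by (auto simp: F_def f')
  qed
  have "F \<in> finCas"
    using finite_frame_in_Cas[OF F] ok(1) tree_ok_inds by (auto simp: finCas_def F_def f')
  moreover have "kripke_model ?K M"
    unfolding kripke_model_def
  proof (intro conjI ballI allI impI)
    show "kripke_frame (frame M)"
      using F by (simp add: M_def)
  next
    fix w c
    assume "w \<in> worlds (frame M)" and c: "c \<in> ?K"
    then obtain s where s: "s \<in> ?S" "w = f s"
      by (auto simp: M_def F_def)
    then have "c \<in> inds s"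
      using c t(2) ok(2) by blast
    then show "cint M w c \<in> indiv (frame M) w"
      by (simp add: M_def F_def s f')
  next
    fix w p
    assume "w \<in> worlds (frame M)"
    then obtain s where s: "s \<in> ?S" "w = f s"
      by (auto simp: M_def F_def)
    show "pint M w p \<subseteq> lists (indiv (frame M) w)"
      using tree_ok_facts[OF ok(1)[OF s(1)], of p] by (fastforce simp: M_def F_def s f')
  next
    fix u v p
    assume "(u, v) \<in> acc (frame M)"
    then obtain s r where "u = f s" "v = f r" "s \<in> ?S" "r \<in> subtrees s"
      by (auto simp: F_def M_def)
    then show "pint M u p \<subseteq> pint M v p"
      using mono[of s r] by (auto simp: M_def f')
  qed (simp add: M_def)
  \<comment> \<open>\<open>f\<close> and \<open>g\<close> are known to be injective only on the
    nodes and the individuals of this tree, so assigned values and constants have to be confined to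
    them.\<close>
  moreover have transfer: "forces M (f s) (\<lambda>x. g (e x)) B \<longleftrightarrow> forces tree_model s e B"
    if "s \<in> ?S" "e ` free_vars B \<subseteq> inds s" "fm_consts B \<subseteq> inds t" for s e B
    using that
  proof (induction B arbitrary: s e)
    case (Atom p us)
    let ?as = "map (trm_val (\<lambda>c. c) e) us"
    have as: "set ?as \<subseteq> X"
    proof -
      have "trm_val (\<lambda>c. c) e u \<in> inds s" if u: "u \<in> set us" for u
      proof (cases u)
        case (Var x)
        then have "x \<in> free_vars (Atom p us)"
          using u by force
        then show ?thesis
          using Atom.prems(2) Var by auto
      next
        case (Const c)
        then have "c \<in> fm_consts (Atom p us)"
          using u by force
        then show ?thesis
          using Atom.prems(3) ok(2)[OF Atom.prems(1)] Const by auto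
      qed
      then show ?thesis
        using ok(3)[OF Atom.prems(1)] by auto
    qed
    have "trm_val g (\<lambda>x. g (e x)) u = g (trm_val (\<lambda>c. c) e u)" for u
      by (cases u) auto
    then have eq: "map (trm_val g (\<lambda>x. g (e x))) us = map g ?as"
      by simp
    have "forces M (f s) (\<lambda>x. g (e x)) (Atom p us) \<longleftrightarrow>
        map (trm_val g (\<lambda>x. g (e x))) us \<in> map g ` {as. (p, as) \<in> facts s}"
      using Atom.prems(1) by (simp add: M_def f')
    also have "\<dots> \<longleftrightarrow> map g ?as \<in> map g ` {as. (p, as) \<in> facts s}"
      by (simp only: eq)
    also have "\<dots> \<longleftrightarrow> (p, ?as) \<in> facts s"
    proof
      assume "map g ?as \<in> map g ` {as. (p, as) \<in> facts s}"
      then obtain bs where bs: "map g ?as = map g bs" "(p, bs) \<in> facts s"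
        by blast
      have "set bs \<subseteq> X"
        using tree_ok_facts[OF ok(1)[OF Atom.prems(1)] bs(2)] ok(3)[OF Atom.prems(1)] by blast
      \<comment> \<open>Injectivity is what reflects atoms: otherwise \<open>map g\<close> could
        identify the argument list with a different one from \<open>facts s\<close>.\<close>
      then have "inj_on g (set ?as \<union> set bs)"
        using as by (intro inj_on_subset[OF g]) blast
      then have "?as = bs"
        using map_inj_on[OF bs(1)] by blast
      with bs(2) show "(p, ?as) \<in> facts s"
        by simp
    qed blast
    finally show ?case
      by simp
  next
    case (Imp B1 B2)
    have "forces M (f r) (\<lambda>x. g (e x)) B1 \<longleftrightarrow> forces tree_model r e B1"
      "forces M (f r) (\<lambda>x. g (e x)) B2 \<longleftrightarrow> forces tree_model r e B2" if "r \<in> subtrees s" for r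
      using mono[OF Imp.prems(1) that] Imp.prems by (intro Imp.IH; auto)+
    then show ?case
      using acc[OF Imp.prems(1)] ok(1)[OF Imp.prems(1)] by (auto simp: M_def)
  next
    case (And B1 B2)
    then show ?case
      by (auto simp: image_Un)
  next
    case (Or B1 B2)
    then show ?case
      by (auto simp: image_Un)
  next
    case (All x B)
    have "forces M (f r) ((\<lambda>x. g (e x))(x := g d)) B \<longleftrightarrow> forces tree_model r (e(x := d)) B"
      if r: "r \<in> subtrees s" and d: "d \<in> inds r" for r d
    proof -
      have "(\<lambda>x. g (e x))(x := g d) = (\<lambda>y. g ((e(x := d)) y))"
        by auto
      moreover have "forces M (f r) (\<lambda>y. g ((e(x := d)) y)) B \<longleftrightarrow> forces tree_model r (e(x := d)) B"
        using mono[OF All.prems(1) r] All.prems d by (intro All.IH) auto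
      ultimately show ?thesis
        by (simp only:)
    qed
    moreover have "indiv (frame M) (f r) = g ` inds r" if "r \<in> subtrees s" for r
      using mono(3)[OF All.prems(1) that] by (simp add: M_def F_def f')
    moreover have "(f s, w) \<in> acc (frame M) \<longleftrightarrow> (\<exists>r\<in>subtrees s. w = f r)" for w
      using acc[OF All.prems(1)] by (simp add: M_def)
    ultimately show ?case
      using ok(1)[OF All.prems(1)] by auto
  next
    case (Ex x B)
    have "forces M (f s) ((\<lambda>x. g (e x))(x := g d)) B \<longleftrightarrow> forces tree_model s (e(x := d)) B"
      if d: "d \<in> inds s" for d
    proof -
      have "(\<lambda>x. g (e x))(x := g d) = (\<lambda>y. g ((e(x := d)) y))"
        by auto
      moreover have "forces M (f s) (\<lambda>y. g ((e(x := d)) y)) B \<longleftrightarrow> forces tree_model s (e(x := d)) B"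
        using Ex.prems d by (intro Ex.IH) auto
      ultimately show ?thesis
        by (simp only:)
    qed
    moreover have "indiv (frame M) (f s) = g ` inds s"
      using Ex.prems(1) by (simp add: M_def F_def f')
    ultimately show ?case
      by auto
  qed simp
  ultimately have impl: "\<forall>w\<in>f ` ?S. true_at M w A" if "\<forall>B\<in>T. \<forall>w\<in>f ` ?S. true_at M w B"
    using cons that unfolding consequence_def by (simp add: M_def F_def)
  have fr: "kripke_frame (frame tree_model)"
    using kripke_model_tree_model unfolding kripke_model_def by blast
  have iff: "true_at M (f s) B \<longleftrightarrow> true_at tree_model s B" if "s \<in> ?S" "B \<in> T \<union> {A}" for s B
  proof -
    have fv: "free_vars B = {}" and cs: "fm_consts B \<subseteq> inds t"
      using that(2) closed t(2) by auto
    \<comment> \<open>The domain may be empty, but for a closed formula the condition on the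
      assignment is vacuous, and \<open>g undefined\<close> gives the assignment the form that
      \<open>transfer\<close> expects.\<close>
    have "forces M (f s) (\<lambda>x. g undefined) B \<longleftrightarrow> forces tree_model s (\<lambda>x. undefined) B"
      using transfer[OF that(1), of "\<lambda>x. undefined" B] fv cs by simp
    moreover have "true_at M (f s) B \<longleftrightarrow> forces M (f s) (\<lambda>x. g undefined) B"
      using that(1) F by (intro true_at_closed[OF _ _ fv]) (simp_all add: M_def, simp add: F_def)
    moreover have "true_at tree_model s B \<longleftrightarrow> forces tree_model s (\<lambda>x. undefined) B"
      using ok(1)[OF that(1)] by (intro true_at_closed[OF fr _ fv]) simp
    ultimately show ?thesis
      by simp
  qed
  have "true_at M w B" if "B \<in> T" "w \<in> f ` ?S" for B w
    using that iff tree_true_mono[OF _ t(1)] t(3) by auto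
  then show "true_at tree_model t A"
    using impl iff[of t A] by simp
qed

theorem theorem4:
  fixes \<O>\<^sub>0 :: "('p, 'a) fm set" and \<phi> :: "('p, 'a) fm"
    and \<Gamma> :: "('p, 'a) fm set" and \<Delta>\<^sub>0 :: "'a set"
  assumes "infinite (UNIV :: 'a set)"
    and "infinite (UNIV :: 'w set)"
    and "infinite (UNIV :: 'd set)"
    and "finite \<O>\<^sub>0"
    and "\<forall>A\<in>\<O>\<^sub>0. closed_fm A"
    and "closed_fm \<phi>"
    and "\<Gamma> = \<O>\<^sub>0 \<union> {\<phi>}"
    and "\<Delta>\<^sub>0 = (\<Union>A\<in>\<Gamma>. fm_consts A)"
  shows "(\<exists>\<sigma>. prp_winning_strategy \<Gamma> \<lparr>opp = \<O>\<^sub>0, prp = {\<phi>}, objs = \<Delta>\<^sub>0\<rparr> \<sigma>) \<longleftrightarrow>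
         consequence \<O>\<^sub>0 (finCas :: ('w, 'd) kframe set) \<phi>"
proof
  assume "\<exists>\<sigma>. prp_winning_strategy \<Gamma> \<lparr>opp = \<O>\<^sub>0, prp = {\<phi>}, objs = \<Delta>\<^sub>0\<rparr> \<sigma>"
  then show "consequence \<O>\<^sub>0 (finCas :: ('w, 'd) kframe set) \<phi>"
    using winning_imp_consequence[OF assms(1,4-8)] by blast
next
  assume cons: "consequence \<O>\<^sub>0 (finCas :: ('w, 'd) kframe set) \<phi>"
  have "tree_cons \<Delta>\<^sub>0 \<O>\<^sub>0 \<phi>"
    using consequence_imp_tree_cons[OF assms(2,3) cons] assms(5-8) by (simp add: closed_fm_def)
  moreover have "finite \<Gamma>"
    using assms(4,7) by simp
  moreover from this have "finite \<Delta>\<^sub>0"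
    using assms(8) by simp
  moreover have "A \<in> inst_fms \<Gamma> \<Delta>\<^sub>0" if "A \<in> \<Gamma>" for A
    using that assms(5-7) by (intro closed_in_inst_fms) auto
  ultimately have "sound_position \<Gamma> \<lparr>opp = \<O>\<^sub>0, prp = {\<phi>}, objs = \<Delta>\<^sub>0\<rparr>"
    using assms(7,8) by (auto simp: sound_position_def)
  with \<open>finite \<Gamma>\<close> show "\<exists>\<sigma>. prp_winning_strategy \<Gamma> \<lparr>opp = \<O>\<^sub>0, prp = {\<phi>}, objs = \<Delta>\<^sub>0\<rparr> \<sigma>"
    using prp_reply_winning by blast
qed

end
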